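(* Let $p\ge3$ be a prime, $p\nmid r$ and $2p<r\equiv1\bmod(p-1)$. (i) If $\Sigma_p(r-p)=p-1$, then $X_{r-p,\,r}\cong V_{2p-1}$ as an $M$-module. (ii) If $\Sigma_p(r-p)>p-1$, then there is a short exact sequence of $M$-modules $$0\to V_1\otimes D^{p-1}\to X_{r-p,\,r}\to V_{2p-1}\to0.$$
   Context: Let $M=\mathrm{M}_2(\mathbb{F}_p)$, the multiplicative semigroup of $2\times2$ matrices, and $\Gamma=\mathrm{GL}_2(\mathbb{F}_p)$. $V_n$ is the $\mathbb{F}_p$-space of homogeneous polynomials $F(X,Y)$ of degree $n$ over $\mathbb{F}_p$, with action of $M$ given by $\begin{pmatrix} a&b\\c&d\end{pmatrix}\cdot F(X,Y)=F(aX+cY,\,bX+dY)$. $X_{r-p,\,r}\subseteq V_r$ is the $\mathbb{F}_p[\Gamma]$-submodule generated by $X^{r-p}Y^{p}$; it is $M$-stable. $D$ is the determinant character, viewed on $M$ as $\det: M\to\mathbb{F}_p$ (so positive powers of $D$ vanish on singular matrices). $\Sigma_p(n)$ is the sum of the base $p$ digits of $n$. *)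

theory Defs
  imports
    "HOL-Analysis.Analysis"
    "Berlekamp_Zassenhaus.Finite_Field"
begin

unbundle no fps_syntax

text \<open>
  The prime field with \<open>p\<close> elements is \<^typ>\<open>'p::prime_card mod_ring\<close>, where \<open>p = CARD('p)\<close>; the
  class \<^class>\<open>prime_card\<close> says that this cardinality is prime.
\<close>

definition digit_sum :: "nat \<Rightarrow> nat \<Rightarrow> nat" where
  \<comment> \<open>for \<open>p \<ge> 2\<close> all digits at positions \<open>i > n\<close> vanish\<close>
  "digit_sum p n = (\<Sum>i\<le>n. (n div p ^ i) mod p)"


section \<open>Modules over the monoid of two by two matrices\<close>

locale M_module = vector_space scl
  for scl :: "'k::field \<Rightarrow> 'v::ab_group_add \<Rightarrow> 'v" +
  fixes V :: "'v set" and act :: "'k^2^2 \<Rightarrow> 'v \<Rightarrow> 'v"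
  assumes V_subspace: "subspace V"
    and act_closed: "v \<in> V \<Longrightarrow> act A v \<in> V"
    and act_add: "v \<in> V \<Longrightarrow> w \<in> V \<Longrightarrow> act A (v + w) = act A v + act A w"
    and act_scale: "v \<in> V \<Longrightarrow> act A (scl c v) = scl c (act A v)"
    and act_one: "v \<in> V \<Longrightarrow> act (mat 1) v = v"
    and act_mult: "v \<in> V \<Longrightarrow> act (A ** B) v = act A (act B v)"

definition M_hom ::
  "('k::field \<Rightarrow> 'v::ab_group_add \<Rightarrow> 'v) \<Rightarrow> 'v set \<Rightarrow> ('k^2^2 \<Rightarrow> 'v \<Rightarrow> 'v) \<Rightarrow>
    'v set \<Rightarrow> ('k^2^2 \<Rightarrow> 'v \<Rightarrow> 'v) \<Rightarrow> ('v \<Rightarrow> 'v) \<Rightarrow> bool" where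
  "M_hom scl V \<rho> W \<sigma> f \<longleftrightarrow>
     M_module scl V \<rho> \<and> M_module scl W \<sigma> \<and>
     (\<forall>v\<in>V. f v \<in> W) \<and>
     (\<forall>v\<in>V. \<forall>w\<in>V. f (v + w) = f v + f w) \<and>
     (\<forall>c. \<forall>v\<in>V. f (scl c v) = scl c (f v)) \<and>
     (\<forall>A. \<forall>v\<in>V. f (\<rho> A v) = \<sigma> A (f v))"

definition M_isomorphic ::
  "('k::field \<Rightarrow> 'v::ab_group_add \<Rightarrow> 'v) \<Rightarrow> 'v set \<Rightarrow> ('k^2^2 \<Rightarrow> 'v \<Rightarrow> 'v) \<Rightarrow>
    'v set \<Rightarrow> ('k^2^2 \<Rightarrow> 'v \<Rightarrow> 'v) \<Rightarrow> bool" where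
  "M_isomorphic scl V \<rho> W \<sigma> \<longleftrightarrow> (\<exists>f. M_hom scl V \<rho> W \<sigma> f \<and> bij_betw f V W)"

text \<open>Existence of a short exact sequence \<open>0 \<rightarrow> U \<rightarrow> V \<rightarrow> W \<rightarrow> 0\<close>.\<close>

definition M_short_exact ::
  "('k::field \<Rightarrow> 'v::ab_group_add \<Rightarrow> 'v) \<Rightarrow> 'v set \<Rightarrow> ('k^2^2 \<Rightarrow> 'v \<Rightarrow> 'v) \<Rightarrow>
    'v set \<Rightarrow> ('k^2^2 \<Rightarrow> 'v \<Rightarrow> 'v) \<Rightarrow> 'v set \<Rightarrow> ('k^2^2 \<Rightarrow> 'v \<Rightarrow> 'v) \<Rightarrow> bool" where
  "M_short_exact scl U \<rho> V \<sigma> W \<tau> \<longleftrightarrow>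
     (\<exists>f g. M_hom scl U \<rho> V \<sigma> f \<and> M_hom scl V \<sigma> W \<tau> g \<and>
            inj_on f U \<and> f ` U = {v \<in> V. g v = 0} \<and> g ` V = W)"

text \<open>
  \<open>V \<otimes> D\<^sup>k\<close>: as \<open>D\<^sup>k\<close> is one-dimensional, \<open>v \<otimes> 1\<close> is identified with \<open>v\<close>, so that the
  underlying space is still \<open>V\<close> and \<open>A\<close> acts through its old action multiplied by \<open>det A ^ k\<close>.
\<close>

definition det_twist ::
  "('k::field \<Rightarrow> 'v \<Rightarrow> 'v) \<Rightarrow> nat \<Rightarrow> ('k^2^2 \<Rightarrow> 'v \<Rightarrow> 'v) \<Rightarrow> 'k^2^2 \<Rightarrow> 'v \<Rightarrow> 'v" where
  "det_twist scl k \<rho> A v = scl (det A ^ k) (\<rho> A v)"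


section \<open>Binary forms\<close>

text \<open>
  Polynomials in \<open>X, Y\<close> are polynomials in \<open>Y\<close> whose coefficients are polynomials in \<open>X\<close>:
  the coefficient of \<open>X\<^sup>i Y\<^sup>j\<close> in \<open>F\<close> is \<open>poly.coeff (poly.coeff F j) i\<close>.
\<close>

definition const2 :: "'k::field \<Rightarrow> 'k poly poly" where
  "const2 c = [:[:c:]:]"

definition varX :: "'k::field poly poly" where
  "varX = [:[:0, 1:]:]"

definition varY :: "'k::field poly poly" where
  "varY = [:0, 1:]"

definition scale2 :: "'k::field \<Rightarrow> 'k poly poly \<Rightarrow> 'k poly poly" where
  "scale2 c F = const2 c * F"

text \<open>\<open>subst2 F P Q\<close> is \<open>F(P, Q)\<close>.\<close>

definition subst2 :: "'k::field poly poly \<Rightarrow> 'k poly poly \<Rightarrow> 'k poly poly \<Rightarrow> 'k poly poly" where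
  "subst2 F P Q = poly (map_poly (\<lambda>f. poly (map_poly const2 f) P) F) Q"

definition binary_forms :: "nat \<Rightarrow> 'k::field poly poly set" where
  "binary_forms n = {F. \<forall>i j. poly.coeff (poly.coeff F j) i \<noteq> 0 \<longrightarrow> i + j = n}"

definition mat_act :: "'k::field^2^2 \<Rightarrow> 'k poly poly \<Rightarrow> 'k poly poly" where
  "mat_act A F =
     subst2 F (const2 (A$1$1) * varX + const2 (A$2$1) * varY)
              (const2 (A$1$2) * varX + const2 (A$2$2) * varY)"

definition GL_submodule_gen :: "'k::field poly poly \<Rightarrow> 'k poly poly set" where
  "GL_submodule_gen F =
     (\<lambda>S. module.subspace scale2 S \<and> (\<forall>A. invertible A \<longrightarrow> (\<forall>G\<in>S. mat_act A G \<in> S))) hull {F}"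

text \<open>\<open>X_module s r\<close> is \<open>X\<^bsub>s,r\<^esub>\<close>, for \<open>s \<le> r\<close>.\<close>

definition X_module :: "nat \<Rightarrow> nat \<Rightarrow> 'k::field poly poly set" where
  "X_module s r = GL_submodule_gen (varX ^ s * varY ^ (r - s))"

end

theory Submission
  imports Defs
begin

text \<open>
  Put \<open>n = r - p\<close>, so that \<open>p - 1\<close> divides \<open>n\<close> and \<open>p\<close> does not. For a vector \<open>u\<close> let
  \<open>\<ell>\<^sub>u = u\<^sub>1 X + u\<^sub>2 Y\<close>; a matrix \<open>A\<close> sends \<open>\<ell>\<^sub>u\<close> to \<open>\<ell>\<^bsub>Au\<^esub>\<close>. Since \<open>p\<close>-th powers are additive,
  \<open>A\<close> sends \<open>X\<^sup>n Y\<^sup>p\<close> to \<open>\<ell>\<^sub>u\<^sup>n (w\<^sub>1 X\<^sup>p + w\<^sub>2 Y\<^sup>p)\<close>, where \<open>u\<close> and \<open>w\<close> are the columns of \<open>A\<close>.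
  Hence the submodule generated by \<open>X\<^sup>n Y\<^sup>p\<close> is \<open>P\<^sub>n X\<^sup>p + P\<^sub>n Y\<^sup>p\<close>, where \<open>P\<^sub>n\<close> is the span of all
  \<open>\<ell>\<^sub>u\<^sup>n\<close> (\<open>X_module_eq_pair_forms\<close>). The target has the same shape:
  \<open>V\<^bsub>2p-1\<^esub> = P\<^bsub>p-1\<^esub> X\<^sup>p + P\<^bsub>p-1\<^esub> Y\<^sup>p\<close> because \<open>P\<^bsub>p-1\<^esub>\<close> is all of \<open>V\<^bsub>p-1\<^esub>\<close>
  (\<open>binary_forms_eq_pair_forms\<close>).

  The map is induced by replacing \<open>\<ell>\<^sub>u\<^sup>n\<close> with \<open>\<ell>\<^sub>u\<^bsup>p-1\<^esup>\<close>. It commutes with every matrix, so the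
  content is that it is well defined, and what its kernel is. The coefficients of
  \<open>\<Sum>\<^sub>u v(u) \<ell>\<^sub>u\<^sup>n\<close> are \<open>binom(n, i)\<close> times the moments \<open>\<Sum>\<^sub>u v(u) u\<^sub>1\<^bsup>n-i\<^esup> u\<^sub>2\<^bsup>i\<^esup>\<close>, and a
  moment depends on its two exponents only modulo \<open>p - 1\<close>, apart from whether they are zero.
  So everything hinges on which residues of \<open>i\<close> carry a binomial coefficient prime to \<open>p\<close>. By
  Legendre's formula \<open>binom(n, i)\<close> is prime to \<open>p\<close> iff the digit sums of \<open>i\<close> and \<open>n - i\<close> add up
  to that of \<open>n\<close>, and digits can be split off so as to reach every smaller digit sum
  (\<open>ex_binomial_not_dvd\<close>). Therefore

  \<^item> a relation among the \<open>\<ell>\<^sub>u\<^sup>n\<close> is also one among the \<open>\<ell>\<^sub>u\<^bsup>p-1\<^esup>\<close> (\<open>power_form_reduce\<close>);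

  \<^item> the only moment seen by exponent \<open>n\<close> but not by \<open>p - 1\<close> is the one with both exponents
    positive multiples of \<open>p - 1\<close>, so the kernel of \<open>P\<^sub>n \<rightarrow> P\<^bsub>p-1\<^esub>\<close> is spanned by
    \<open>\<Theta> = \<Sum>\<^sub>u \<ell>\<^sub>u\<^sup>n\<close> (\<open>power_form_of_kernel\<close>);

  \<^item> \<open>\<Theta>\<close> vanishes iff the digit sum of \<open>n\<close> is \<open>p - 1\<close> (\<open>power_form_one_eq_0_iff\<close>), and
    \<open>A \<Theta> = det(A)\<^bsup>p-1\<^esup> \<Theta>\<close> (\<open>mat_act_power_form_one\<close>).

  It remains to see that \<open>P\<^sub>n X\<^sup>p + P\<^sub>n Y\<^sup>p\<close> is a direct sum (\<open>pair_form_eq_0\<close>); this is where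
  \<open>p\<close> not dividing \<open>n\<close> enters. If \<open>X\<^sup>p f = Y\<^sup>p g\<close> with \<open>f, g \<in> P\<^sub>n\<close> and \<open>f\<close> is nonzero, the
  differences of \<open>f\<close> under the shears \<open>X \<mapsto> X + tY\<close> satisfy a relation of the same kind and are
  divisible by a higher power of \<open>Y\<close>, so \<open>f\<close> may be taken invariant under all shears. Invariance
  leaves only the coefficients of \<open>f\<close> at multiples of \<open>p - 1\<close>. These are coefficients of \<open>g\<close>
  governed by the same moment as the coefficient of \<open>X Y\<^bsup>n-1\<^esup>\<close> in \<open>g\<close>, which is \<open>n\<close> times that
  moment and vanishes by the relation. So \<open>g = 0\<close>, a contradiction.

  The kernel of the map is then spanned by \<open>\<Theta> X\<^sup>p\<close> and \<open>\<Theta> Y\<^sup>p\<close>. It is the image of \<open>V\<^sub>1\<close> under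
  \<open>F \<mapsto> \<Theta> F\<^sup>p\<close>, and the twist comes from the action on \<open>\<Theta>\<close>.
\<close>


section \<open>Base \<open>p\<close> digits and binomial coefficients\<close>

lemma digit_sum_rec:
  assumes "p \<ge> 2"
  shows "digit_sum p n = n mod p + digit_sum p (n div p)"
proof -
  have *: "(\<Sum>i\<le>m. (n div p ^ i) mod p) = digit_sum p n" if "n \<le> m" for m n
  proof -
    have "(n div p ^ i) mod p = 0" if "i > n" for i
    proof -
      have "n < p ^ n" using assms by (intro power_gt_expt) auto
      also have "\<dots> \<le> p ^ i" using that assms by (intro power_increasing) auto
      finally show ?thesis by simp
    qed
    thus ?thesis unfolding digit_sum_def using that
      by (intro sum.mono_neutral_right) auto
  qed
  have "digit_sum p n = (\<Sum>i\<le>Suc n. (n div p ^ i) mod p)" using *[of n "Suc n"] by simp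
  also have "\<dots> = n mod p + (\<Sum>i\<le>n. (n div p div p ^ i) mod p)"
    by (subst sum.atMost_Suc_shift) (simp add: div_mult2_eq)
  also have "(\<Sum>i\<le>n. (n div p div p ^ i) mod p) = digit_sum p (n div p)"
    by (rule *) simp
  finally show ?thesis .
qed

lemma digit_sum_0 [simp]: "digit_sum p 0 = 0"
  by (simp add: digit_sum_def)

lemma digit_sum_add_mult:
  assumes "p \<ge> 2" "d < p"
  shows "digit_sum p (d + p * m) = d + digit_sum p m"
  using digit_sum_rec[OF assms(1), of "d + p * m"] assms by simp

lemma digit_sum_pos:
  assumes "p \<ge> 2" "n > 0"
  shows "digit_sum p n > 0"
  using assms(2)
proof (induction n rule: less_induct)
  case (less n)
  show ?case
  proof (cases "n mod p = 0")
    case True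
    hence "n div p > 0" "n div p < n" using less.prems assms(1)
      by (auto simp: div_greater_zero_iff dvd_imp_le mod_eq_0_iff_dvd)
    thus ?thesis using less.IH[of "n div p"] digit_sum_rec[OF assms(1), of n] by simp
  next
    case False
    thus ?thesis using digit_sum_rec[OF assms(1), of n] by simp
  qed
qed

text \<open>
  Legendre's formula for the exponent of \<open>p\<close> in \<open>n!\<close>. Passing from \<open>n - 1\<close> to \<open>n\<close> raises the digit
  sum by one, except that each trailing digit \<open>p - 1\<close> that rolls over to zero costs \<open>p - 1\<close>; the
  number of these digits is the multiplicity of \<open>p\<close> in \<open>n\<close>.
\<close>
lemma legendre_digit_sum:
  assumes p: "prime p"
  shows "(p - 1) * multiplicity p (fact n :: nat) + digit_sum p n = n"
proof (induction n rule: less_induct)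
  case (less n)
  have p2: "p \<ge> 2" using p by (rule prime_ge_2_nat)
  show ?case
  proof (cases n)
    case 0
    thus ?thesis by simp
  next
    case (Suc m)
    have mult: "multiplicity p (fact n :: nat) = multiplicity p n + multiplicity p (fact m :: nat)"
      using p unfolding Suc fact_Suc by (subst prime_elem_multiplicity_mult_distrib) auto
    show ?thesis
    proof (cases "p dvd n")
      case False
      have "n mod p \<noteq> 0" using False by (simp add: mod_eq_0_iff_dvd)
      then obtain d where d: "n mod p = Suc d" using not0_implies_Suc by blast
      have "d < p" "Suc d < p" using d p2 mod_less_divisor[of p n] by linarith+
      have n: "n = Suc d + p * (n div p)" using d by (metis mod_mult_div_eq)
      hence m: "m = d + p * (n div p)" using Suc by simp
      have "digit_sum p n = Suc d + digit_sum p (n div p)"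
        by (subst n, subst digit_sum_add_mult) (use p2 \<open>Suc d < p\<close> in auto)
      moreover have "digit_sum p m = d + digit_sum p (n div p)"
        by (subst m, subst digit_sum_add_mult) (use p2 \<open>d < p\<close> in auto)
      moreover have "multiplicity p n = 0" using False by (rule not_dvd_imp_multiplicity_0)
      ultimately show ?thesis using less.IH[of m] mult Suc by simp
    next
      case True
      then obtain q where q: "n = p * q" by (auto elim: dvdE)
      with Suc obtain q' where q': "q = Suc q'" by (cases q) auto
      have m: "m = (p - 1) + p * q'" using q q' Suc p2 by simp
      have "1 * q < p * q" using q' p2 by (intro mult_strict_right_mono) auto
      hence "q < n" using q by simp
      have 1: "digit_sum p n = digit_sum p q"
        using digit_sum_add_mult[of p 0 q] p2 q by simp
      have 2: "digit_sum p m = (p - 1) + digit_sum p q'"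
        by (subst m, subst digit_sum_add_mult) (use p2 in auto)
      have 3: "multiplicity p n = Suc (multiplicity p q)"
        using p q' p2 unfolding q by (subst prime_elem_multiplicity_mult_distrib) auto
      have 4: "multiplicity p (fact q :: nat) = multiplicity p q + multiplicity p (fact q' :: nat)"
        using p unfolding q' fact_Suc by (subst prime_elem_multiplicity_mult_distrib) auto
      have "(p - 1) * multiplicity p (fact q :: nat) + digit_sum p q = q"
        using less.IH[OF \<open>q < n\<close>] .
      moreover have "(p - 1) * multiplicity p (fact q' :: nat) + digit_sum p q' = q'"
        using less.IH[of q'] \<open>q < n\<close> q' by simp
      moreover have "(p - 1) * multiplicity p (fact m :: nat) + digit_sum p m = m"
        using less.IH[of m] Suc by simp
      ultimately show ?thesis
        unfolding mult 1 2 3 4 using Suc q'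
        by (simp add: algebra_simps)
    qed
  qed
qed

lemma cong_digit_sum:
  assumes "prime p"
  shows "[digit_sum p n = n] (mod (p - 1))"
  using legendre_digit_sum[OF assms, of n] by (metis cong_def mod_mult_self4)

text \<open>
  Kummer's criterion: by Legendre's formula, \<open>p - 1\<close> times the multiplicity of \<open>p\<close> in the binomial
  coefficient is the amount by which the digit sums of \<open>i\<close> and \<open>n - i\<close> together exceed that of \<open>n\<close>.
\<close>
lemma not_dvd_binomial_iff:
  assumes p: "prime p" and "i \<le> n"
  shows "\<not> p dvd (n choose i) \<longleftrightarrow> digit_sum p n = digit_sum p i + digit_sum p (n - i)"
proof -
  have "p \<ge> 2" using p by (rule prime_ge_2_nat)
  have c: "(n choose i) \<noteq> 0" using assms by simp
  have "fact i * fact (n - i) * (n choose i) = (fact n :: nat)"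
    using binomial_fact_lemma[OF assms(2)] .
  hence v: "multiplicity p (fact n :: nat) =
      multiplicity p (fact i :: nat) + multiplicity p (fact (n - i) :: nat) + multiplicity p (n choose i)"
    using p c by (metis prime_elem_multiplicity_mult_distrib fact_nonzero mult_eq_0_iff
        prime_imp_prime_elem)
  define a b e where "a = multiplicity p (fact i :: nat)"
    and "b = multiplicity p (fact (n - i) :: nat)" and "e = multiplicity p (n choose i)"
  have "(p - 1) * (a + b + e) + digit_sum p n = n"
    using legendre_digit_sum[OF p, of n] v by (simp add: a_def b_def e_def)
  moreover have "(p - 1) * a + digit_sum p i = i" "(p - 1) * b + digit_sum p (n - i) = n - i"
    unfolding a_def b_def by (rule legendre_digit_sum[OF p])+
  ultimately have "(p - 1) * e + digit_sum p n = digit_sum p i + digit_sum p (n - i)"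
    using assms(2) unfolding distrib_left by linarith
  moreover have "p dvd (n choose i) \<longleftrightarrow> e \<noteq> 0"
    using p c prime_multiplicity_gt_zero_iff[of p "n choose i"] unfolding e_def by simp
  ultimately show ?thesis using \<open>p \<ge> 2\<close> by auto
qed

text \<open>
  Take the \<open>j\<close> units from the digits of \<open>n\<close>, lowest digit first; nothing is ever carried, so the rest
  \<open>n - i\<close> keeps exactly the remaining units.
\<close>
lemma split_digit_sum:
  assumes "p \<ge> 2" "j \<le> digit_sum p n"
  shows "\<exists>i\<le>n. digit_sum p i = j \<and> digit_sum p (n - i) = digit_sum p n - j"
  using assms(2)
proof (induction n arbitrary: j rule: less_induct)
  case (less n)
  show ?case
  proof (cases "n = 0")
    case True
    thus ?thesis using less.prems by simp
  next
    case False
    define d q where "d = n mod p" and "q = n div p"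
    have n: "n = d + p * q" unfolding d_def q_def by simp
    have "d < p" using assms unfolding d_def by simp
    have S: "digit_sum p n = d + digit_sum p q"
      using digit_sum_rec[OF assms(1), of n] unfolding d_def q_def .
    define j0 where "j0 = min d j"
    have "j - j0 \<le> digit_sum p q" using less.prems S unfolding j0_def by linarith
    moreover have "q < n" using False assms(1) unfolding q_def by simp
    ultimately obtain i where i: "i \<le> q" "digit_sum p i = j - j0"
      "digit_sum p (q - i) = digit_sum p q - (j - j0)"
      using less.IH by blast
    have "n - (j0 + p * i) = (d - j0) + p * (q - i)"
      using i(1) n unfolding j0_def by (simp add: diff_mult_distrib2)
    moreover have "j0 + p * i \<le> n" using i(1) n unfolding j0_def by (simp add: add_mono)
    moreover have "digit_sum p (j0 + p * i) = j0 + digit_sum p i"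
      using \<open>d < p\<close> assms(1) unfolding j0_def by (intro digit_sum_add_mult) auto
    moreover have "digit_sum p ((d - j0) + p * (q - i)) = (d - j0) + digit_sum p (q - i)"
      using \<open>d < p\<close> assms(1) by (intro digit_sum_add_mult) auto
    moreover have "j0 \<le> d" "j0 \<le> j" unfolding j0_def by auto
    ultimately show ?thesis
      using i(2,3) S \<open>j - j0 \<le> digit_sum p q\<close>
      by (intro exI[of _ "j0 + p * i"]) auto
  qed
qed

lemma ex_binomial_not_dvd:
  assumes "prime p" "j < digit_sum p n" "j > 0"
  shows "\<exists>i. 0 < i \<and> i < n \<and> [i = j] (mod (p - 1)) \<and> \<not> p dvd (n choose i)"
proof -
  have p2: "p \<ge> 2" using assms(1) by (rule prime_ge_2_nat)
  obtain i where i: "i \<le> n" "digit_sum p i = j" "digit_sum p (n - i) = digit_sum p n - j"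
    using split_digit_sum[OF p2, of j n] assms(2) by auto
  have "i \<noteq> 0" using i(2) assms(3) by (intro notI) simp
  moreover have "i \<noteq> n" using i(2) assms(2) by auto
  moreover have "[i = j] (mod (p - 1))"
    using cong_digit_sum[OF assms(1), of i] i(2) by (simp add: cong_sym)
  moreover have "\<not> p dvd (n choose i)"
    using not_dvd_binomial_iff[OF assms(1) i(1)] i assms(2) by simp
  ultimately show ?thesis using i(1) by auto
qed

lemma digit_sum_ge:
  assumes "prime p" "n > 0" "(p - 1) dvd n"
  shows "p - 1 \<le> digit_sum p n"
proof -
  have "(p - 1) dvd digit_sum p n"
    using cong_digit_sum[OF assms(1), of n] assms(3) by (simp add: cong_dvd_iff)
  thus ?thesis using digit_sum_pos[of p n] prime_ge_2_nat[OF assms(1)] assms(2)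
    by (auto intro: dvd_imp_le)
qed

text \<open>
  A positive multiple of \<open>p - 1\<close> has digit sum at least \<open>p - 1\<close>, so \<open>i\<close> and \<open>n - i\<close> together have too
  many units to add up to \<open>n\<close> without a carry.
\<close>
lemma dvd_binomial_if_digit_sum_minimal:
  assumes p: "prime p" and "digit_sum p n = p - 1" "(p - 1) dvd n"
    and "0 < i" "i < n" "(p - 1) dvd i"
  shows "p dvd (n choose i)"
proof (rule ccontr)
  assume "\<not> p dvd (n choose i)"
  hence "digit_sum p n = digit_sum p i + digit_sum p (n - i)"
    using not_dvd_binomial_iff[OF p, of i n] assms by simp
  moreover have "p - 1 \<le> digit_sum p i" "p - 1 \<le> digit_sum p (n - i)"
    by (rule digit_sum_ge[OF p]; use assms in \<open>simp add: dvd_diff_nat\<close>)+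
  ultimately show False using assms(2) prime_ge_2_nat[OF p] by simp
qed

lemma not_dvd_binomial_pred:
  assumes "prime p" "j \<le> p - 1"
  shows "\<not> p dvd (p - 1 choose j)"
proof
  assume "p dvd (p - 1 choose j)"
  hence "p dvd fact j * fact (p - 1 - j) * (p - 1 choose j)" by simp
  hence "p dvd fact (p - 1)" using binomial_fact_lemma[OF assms(2)] by simp
  thus False using assms(1) prime_gt_1_nat[OF assms(1)] by (simp add: prime_dvd_fact_iff)
qed


section \<open>Power sums over the prime field\<close>

lemma fermat_mod_ring:
  fixes a :: "'p::prime_card mod_ring"
  assumes "a \<noteq> 0"
  shows "a ^ (CARD('p) - 1) = 1"
proof -
  have "a ^ CARD('p) = a"
    using finite_field_power_card_eq_same[of a] by simp
  moreover have "CARD('p) = Suc (CARD('p) - 1)" by simp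
  ultimately have "a * a ^ (CARD('p) - 1) = a" by (metis power_Suc)
  thus ?thesis using assms by simp
qed

lemma power_card_minus_1_dvd:
  fixes a :: "'p::prime_card mod_ring"
  assumes "a \<noteq> 0" "(CARD('p) - 1) dvd n"
  shows "a ^ n = 1"
  using assms fermat_mod_ring[OF assms(1)] by (auto elim!: dvdE simp: power_mult)

lemma power_eq_if_cong:
  fixes a :: "'p::prime_card mod_ring"
  assumes "[m = n] (mod (CARD('p) - 1))" "m > 0" "n > 0"
  shows "a ^ m = a ^ n"
proof -
  have *: "a ^ m = a ^ n" if "[m = n] (mod (CARD('p) - 1))" "m \<le> n" "a \<noteq> 0" for m n
  proof -
    have "(CARD('p) - 1) dvd (n - m)"
      using that by (metis cong_altdef_nat cong_sym)
    hence "a ^ (n - m) = 1" using that(3) power_card_minus_1_dvd by blast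
    thus ?thesis using that(2) by (metis le_add_diff_inverse mult.right_neutral power_add)
  qed
  show ?thesis
  proof (cases "a = 0")
    case True
    thus ?thesis using assms by (simp add: power_0_left)
  next
    case False
    thus ?thesis using *[of m n] *[of n m] assms(1) by (metis cong_sym nat_le_linear)
  qed
qed

lemma poly_eq_0_if_vanishes_mod_ring:
  fixes f :: "'p::prime_card mod_ring poly"
  assumes "degree f < CARD('p)" "\<And>x. poly f x = 0"
  shows "f = 0"
proof (rule ccontr)
  assume "f \<noteq> 0"
  hence "card {x. poly f x = 0} \<le> degree f" by (rule card_poly_roots_bound)
  thus False using assms by simp
qed

text \<open>
  Multiplication by a nonzero \<open>b\<close> permutes the field, so the sum is fixed by the factor \<open>b\<^sup>n\<close>. Some
  \<open>b\<close> makes this factor different from \<open>1\<close> unless \<open>p - 1\<close> divides \<open>n\<close>.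
\<close>
lemma power_sum_mod_ring:
  "(\<Sum>a\<in>UNIV. (a :: 'p::prime_card mod_ring) ^ n) =
     (if n > 0 \<and> (CARD('p) - 1) dvd n then - 1 else 0)"
proof (cases "(CARD('p) - 1) dvd n")
  case True
  show ?thesis
  proof (cases "n > 0")
    case True
    have "(\<Sum>a\<in>UNIV. (a :: 'p mod_ring) ^ n) = (\<Sum>a\<in>UNIV - {0}. a ^ n)"
      by (rule sum.mono_neutral_right) (use True in auto)
    also have "\<dots> = (\<Sum>a\<in>UNIV - {0 :: 'p mod_ring}. 1)"
      by (intro sum.cong) (use \<open>(CARD('p) - 1) dvd n\<close> in \<open>auto simp: power_card_minus_1_dvd\<close>)
    also have "\<dots> = of_nat (CARD('p) - 1)" by (simp add: card_Diff_singleton)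
    also have "\<dots> = of_nat CARD('p) - 1" by (simp add: of_nat_diff Suc_leI)
    finally show ?thesis using True \<open>(CARD('p) - 1) dvd n\<close> by simp
  qed simp
next
  case False
  define m where "m = n mod (CARD('p) - 1)"
  have p1: "CARD('p) > 1" using prime_card[where 'a = 'p] prime_gt_1_nat by blast
  have m: "0 < m" "m < CARD('p) - 1" using False p1 unfolding m_def
    by (auto simp: mod_greater_zero_iff_not_dvd)
  have nm: "[n = m] (mod (CARD('p) - 1))" unfolding m_def by (simp add: cong_def)
  have "n > 0" using False by (intro Nat.gr0I) auto
  have "\<exists>b :: 'p mod_ring. b \<noteq> 0 \<and> b ^ m \<noteq> 1"
  proof (rule ccontr)
    assume *: "\<not> ?thesis"
    \<comment> \<open>\<open>X\<^bsup>m+1\<^esup> - X\<close> rather than \<open>X\<^sup>m - 1\<close>, so that \<open>0\<close> is also a root\<close>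
    define f :: "'p mod_ring poly" where "f = Polynomial.monom 1 (Suc m) - Polynomial.monom 1 1"
    have deg: "degree f < CARD('p)" using m unfolding f_def
      by (intro degree_diff_less) (simp_all add: degree_monom_eq)
    have "poly f x = 0" for x using * unfolding f_def
      by (cases "x = 0") (auto simp: poly_monom)
    hence "f = 0" using poly_eq_0_if_vanishes_mod_ring[OF deg] by blast
    hence "poly.coeff f 1 = 0" by simp
    thus False using m unfolding f_def by (simp add: coeff_diff)
  qed
  then obtain b :: "'p mod_ring" where b: "b \<noteq> 0" "b ^ m \<noteq> 1" by blast
  have "b ^ n \<noteq> 1" using power_eq_if_cong[OF nm \<open>n > 0\<close> m(1), of b] b by simp
  have "(\<Sum>a\<in>UNIV. (a :: 'p mod_ring) ^ n) = (\<Sum>a\<in>UNIV. (b * a) ^ n)"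
    by (rule sum.reindex_bij_witness[of _ "\<lambda>a. b * a" "\<lambda>a. a / b"]) (use b in auto)
  also have "\<dots> = b ^ n * (\<Sum>a\<in>UNIV. a ^ n)"
    by (simp add: power_mult_distrib sum_distrib_left)
  finally have "(b ^ n - 1) * (\<Sum>a\<in>UNIV. (a :: 'p mod_ring) ^ n) = 0"
    by (simp add: algebra_simps)
  thus ?thesis using \<open>b ^ n \<noteq> 1\<close> False by simp
qed

lemma of_nat_binomial_eq_0_iff:
  "of_nat (n choose i) = (0 :: 'p::prime_card mod_ring) \<longleftrightarrow> CARD('p) dvd (n choose i)"
  using of_nat_eq_0_iff_char_dvd[where 'a = "'p mod_ring"] by simp

lemma sum_vec2:
  fixes h :: "'k::finite^2 \<Rightarrow> 'b::comm_monoid_add"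
  shows "(\<Sum>u\<in>UNIV. h u) = (\<Sum>x\<in>UNIV. \<Sum>y\<in>UNIV. h (\<chi> i. if i = 1 then x else y))"
proof -
  have "(\<Sum>x\<in>UNIV. \<Sum>y\<in>UNIV. h (\<chi> i. if i = 1 then x else y)) =
      (\<Sum>(x, y)\<in>UNIV. h (\<chi> i. if i = 1 then x else y))"
    by (simp add: sum.cartesian_product)
  also have "\<dots> = (\<Sum>u\<in>UNIV. h u)"
    by (rule sum.reindex_bij_witness[of _ "\<lambda>u. (u$1, u$2)" "\<lambda>(x, y). \<chi> i. if i = 1 then x else y"])
      (auto simp: vec_eq_iff forall_2)
  finally show ?thesis ..
qed

text \<open>
  The plane is a disjoint union of lines in direction \<open>d\<close>. Each has \<open>p\<close> points, so it contributes
  \<open>p\<close> times one value.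
\<close>
lemma sum_translation_invariant_eq_0:
  fixes h :: "'p::prime_card mod_ring^2 \<Rightarrow> 'b::ring_1"
  assumes char: "of_nat CARD('p) = (0 :: 'b)" and "d \<noteq> 0" and inv: "\<And>u c. h (u + c *s d) = h u"
  shows "(\<Sum>u\<in>UNIV. h u) = 0"
proof (cases "d$1 = 0")
  case False
  have "(\<Sum>u\<in>UNIV. h u) = (\<Sum>(x, y)\<in>UNIV. h ((\<chi> i. if i = 1 then 0 else y) + x *s d))"
    by (rule sum.reindex_bij_witness[of _ "\<lambda>(x, y). (\<chi> i. if i = 1 then 0 else y) + x *s d"
          "\<lambda>u. (u$1 / d$1, u$2 - u$1 / d$1 * d$2)"])
      (use False in \<open>auto simp: vec_eq_iff forall_2 intro!: arg_cong[where f = h]\<close>)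
  also have "\<dots> = (\<Sum>x\<in>(UNIV :: 'p mod_ring set). \<Sum>y\<in>UNIV. h (\<chi> i. if i = 1 then 0 else y))"
    by (subst sum.cartesian_product) (simp add: inv split_def)
  finally show ?thesis by (simp add: char)
next
  case True
  hence d2: "d$2 \<noteq> 0" using \<open>d \<noteq> 0\<close> by (auto simp: vec_eq_iff forall_2)
  have "(\<Sum>u\<in>UNIV. h u) = (\<Sum>(x, y)\<in>UNIV. h ((\<chi> i. if i = 1 then y else 0) + x *s d))"
    by (rule sum.reindex_bij_witness[of _ "\<lambda>(x, y). (\<chi> i. if i = 1 then y else 0) + x *s d"
          "\<lambda>u. (u$2 / d$2, u$1)"])
      (use True d2 in \<open>auto simp: vec_eq_iff forall_2 intro!: arg_cong[where f = h]\<close>)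
  also have "\<dots> = (\<Sum>x\<in>(UNIV :: 'p mod_ring set). \<Sum>y\<in>UNIV. h (\<chi> i. if i = 1 then y else 0))"
    by (subst sum.cartesian_product) (simp add: inv split_def)
  finally show ?thesis by (simp add: char)
qed


section \<open>The matrix action on polynomials in two variables\<close>

lemma const2_hom: "comm_ring_hom (const2 :: 'k::field \<Rightarrow> _)"
  by unfold_locales (auto simp: const2_def one_pCons)

interpretation const2: comm_ring_hom "const2 :: 'k::field \<Rightarrow> 'k poly poly"
  by (rule const2_hom)

lemma monomial2_eq: "const2 c * varX ^ a * varY ^ b = Polynomial.monom (Polynomial.monom c a) b"
proof -
  have "(varX :: 'a poly poly) ^ a = [: [:0, 1:] ^ a :]" for a
    unfolding varX_def by (induction a) (auto simp: one_pCons)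
  moreover have "(varY :: 'a poly poly) ^ b = Polynomial.monom 1 b"
    unfolding varY_def by (metis monom_altdef smult_1_left)
  ultimately show ?thesis
    by (simp add: const2_def monom_altdef smult_monom flip: smult_monom)
qed

lemma poly2_expansion:
  "F = (\<Sum>j\<le>degree F. \<Sum>i\<le>degree (poly.coeff F j).
     const2 (poly.coeff (poly.coeff F j) i) * varX ^ i * varY ^ j)"
proof -
  have "F = (\<Sum>j\<le>degree F. Polynomial.monom (poly.coeff F j) j)"
    by (rule poly_as_sum_of_monoms[symmetric])
  also have "\<dots> = (\<Sum>j\<le>degree F. Polynomial.monom (\<Sum>i\<le>degree (poly.coeff F j).
      Polynomial.monom (poly.coeff (poly.coeff F j) i) i) j)"
    by (simp add: poly_as_sum_of_monoms)
  also have "\<dots> = (\<Sum>j\<le>degree F. \<Sum>i\<le>degree (poly.coeff F j).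
     const2 (poly.coeff (poly.coeff F j) i) * varX ^ i * varY ^ j)"
    by (simp add: monomial2_eq monom_hom.hom_sum)
  finally show ?thesis .
qed

text \<open>
  Identities between substitutions are checked on constants and variables only.
\<close>
lemma poly2_hom_eqI:
  assumes "comm_ring_hom \<phi>" "comm_ring_hom \<psi>"
    and "\<And>c. \<phi> (const2 c) = \<psi> (const2 c)" "\<phi> varX = \<psi> varX" "\<phi> varY = \<psi> varY"
  shows "\<phi> F = \<psi> F"
proof -
  interpret \<phi>: comm_ring_hom \<phi> by fact
  interpret \<psi>: comm_ring_hom \<psi> by fact
  show ?thesis
    by (subst (1 2) poly2_expansion)
      (simp add: hom_distribs assms)
qed

lemma subst2_hom: "comm_ring_hom (\<lambda>F. subst2 F P Q)"
proof -
  interpret c: map_poly_comm_ring_hom "const2 :: 'a \<Rightarrow> _" ..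
  interpret inner: comm_ring_hom "\<lambda>f :: 'a poly. poly (map_poly const2 f) P"
    by unfold_locales (simp_all add: hom_distribs)
  interpret m: map_poly_comm_ring_hom "\<lambda>f :: 'a poly. poly (map_poly const2 f) P" ..
  show ?thesis
    unfolding subst2_def by unfold_locales (simp_all add: hom_distribs)
qed

lemma subst2_simps:
  "subst2 (const2 c) P Q = const2 c" "subst2 varX P Q = P" "subst2 varY P Q = Q"
proof -
  interpret c: map_poly_comm_ring_hom "const2 :: 'a \<Rightarrow> _" ..
  interpret inner: comm_ring_hom "\<lambda>f :: 'a poly. poly (map_poly const2 f) P"
    by unfold_locales (simp_all add: hom_distribs)
  show "subst2 (const2 c) P Q = const2 c"
  proof (cases "c = 0")
    case False
    thus ?thesis by (simp only: subst2_def const2_def[of c]) (simp add: map_poly_pCons const2_def)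
  qed (simp add: subst2_def)
  show "subst2 varX P Q = P" "subst2 varY P Q = Q"
    by (simp_all add: subst2_def varX_def varY_def map_poly_pCons)
qed

definition linear_form :: "'k::field^2 \<Rightarrow> 'k poly poly" where
  "linear_form u = const2 (u$1) * varX + const2 (u$2) * varY"

interpretation mat_act: comm_ring_hom "mat_act A :: 'k::field poly poly \<Rightarrow> _"
  unfolding mat_act_def by (rule subst2_hom)

lemma mat_act_simps:
  "mat_act A (const2 c) = const2 c"
  "mat_act A varX = const2 (A$1$1) * varX + const2 (A$2$1) * varY"
  "mat_act A varY = const2 (A$1$2) * varX + const2 (A$2$2) * varY"
  by (simp_all add: mat_act_def subst2_simps)

lemma mat_act_linear_form: "mat_act A (linear_form u) = linear_form (A *v u)"
  by (simp add: linear_form_def mat_act_simps hom_distribs matrix_vector_mult_def sum_2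
      hom_distribs algebra_simps)

lemma mat_act_scale2: "mat_act A (scale2 c F) = scale2 c (mat_act A F)"
  by (simp add: scale2_def mat_act.hom_mult mat_act_simps)

lemma mat_act_mult: "mat_act (A ** B) F = mat_act A (mat_act B F)"
proof (rule poly2_hom_eqI[where \<phi> = "mat_act (A ** B)" and \<psi> = "\<lambda>F. mat_act A (mat_act B F)"])
  show "comm_ring_hom (\<lambda>F. mat_act A (mat_act B F))"
    by unfold_locales (simp_all add: hom_distribs)
qed (simp_all add: mat_act.comm_ring_hom_axioms mat_act_simps hom_distribs
      matrix_matrix_mult_def sum_2 hom_distribs algebra_simps)

lemma mat_act_one: "mat_act (mat 1) F = F"
proof (rule poly2_hom_eqI[where \<phi> = "mat_act (mat 1)" and \<psi> = "\<lambda>F. F"])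
  show "comm_ring_hom (\<lambda>F :: 'a poly poly. F)" by unfold_locales simp_all
qed (simp_all add: mat_act.comm_ring_hom_axioms mat_act_simps mat_def)

lemma vector_space_scale2: "vector_space scale2"
  by unfold_locales (simp_all add: scale2_def hom_distribs algebra_simps)

interpretation scale2: vector_space "scale2 :: 'k::field \<Rightarrow> _"
  by (rule vector_space_scale2)

lemma M_module_mat_act:
  assumes "scale2.subspace V" and "\<And>A F. F \<in> V \<Longrightarrow> mat_act A F \<in> V"
  shows "M_module scale2 V mat_act"
  using assms
  by unfold_locales (simp_all add: mat_act.hom_add mat_act_scale2 mat_act_one mat_act_mult)

lemma const2_power_card: "const2 a ^ CARD('p) = const2 (a :: 'p::prime_card mod_ring)"
  using finite_field_power_card_eq_same[of a] by (simp flip: const2.hom_power)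

lemma poly2_add_power_card:
  fixes F G :: "'p::prime_card mod_ring poly poly"
  shows "(F + G) ^ CARD('p) = F ^ CARD('p) + G ^ CARD('p)"
  by (rule freshmans_dream) (simp_all add: prime_card)

text \<open>
  Entries of a matrix over the prime field are their own \<open>p\<close>-th powers, so \<open>X\<^sup>p\<close> and \<open>Y\<^sup>p\<close> span a
  copy of \<open>V\<^sub>1\<close>.
\<close>
lemma mat_act_frobenius:
  fixes A :: "'p::prime_card mod_ring^2^2"
  shows "mat_act A (varX ^ CARD('p)) =
      const2 (A$1$1) * varX ^ CARD('p) + const2 (A$2$1) * varY ^ CARD('p)"
    and "mat_act A (varY ^ CARD('p)) =
      const2 (A$1$2) * varX ^ CARD('p) + const2 (A$2$2) * varY ^ CARD('p)"
  by (simp_all add: mat_act.hom_power mat_act_simps poly2_add_power_card power_mult_distrib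
      const2_power_card)

definition shear :: "'k::field \<Rightarrow> 'k^2^2" where
  "shear t = (\<chi> i j. if i = j then 1 else if i = 2 then t else 0)"

lemma shear_nth [simp]:
  "shear t $ 1 $ 1 = 1" "shear t $ 2 $ 2 = 1" "shear t $ 2 $ 1 = t" "shear t $ 1 $ 2 = 0"
  by (simp_all add: shear_def)

lemma mat_act_shear: "mat_act (shear t) varX = varX + const2 t * varY" "mat_act (shear t) varY = varY"
  by (simp_all add: mat_act_simps)

text \<open>
  Modulo \<open>Y\<close> the shear is the identity. This is what makes shears act unipotently: taking
  differences raises the power of \<open>Y\<close>.
\<close>
lemma varY_dvd_shear_diff: "varY dvd mat_act (shear t) F - F"
proof -
  have "varY dvd mat_act (shear t) varX ^ i - varX ^ i" for i
    unfolding mat_act_shear by (subst power_diff_sumr2) simp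
  hence "varY dvd const2 c * (mat_act (shear t) varX ^ i - varX ^ i) * varY ^ j" for c i j
    by simp
  moreover have "const2 c * (mat_act (shear t) varX ^ i - varX ^ i) * varY ^ j =
      mat_act (shear t) (const2 c * varX ^ i * varY ^ j) - const2 c * varX ^ i * varY ^ j" for c i j
    by (simp add: hom_distribs mat_act_simps(1) mat_act_shear algebra_simps)
  ultimately have *: "varY dvd mat_act (shear t) (const2 c * varX ^ i * varY ^ j)
      - const2 c * varX ^ i * varY ^ j" for c i j by metis
  show ?thesis
    by (subst (1 2) poly2_expansion[of F])
      (simp only: mat_act.hom_sum flip: sum_subtractf, intro dvd_sum *)
qed

lemma linear_form_axis:
  "linear_form (axis 1 c) = const2 c * varX" "linear_form (axis 2 c) = const2 c * varY"
  by (simp_all add: linear_form_def axis_def)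

definition mat_of_columns :: "'k::field^2 \<Rightarrow> 'k^2 \<Rightarrow> 'k^2^2" where
  "mat_of_columns u w = (\<chi> i j. if j = 1 then u$i else w$i)"

lemma mat_act_mat_of_columns:
  fixes u w :: "'p::prime_card mod_ring^2"
  shows "mat_act (mat_of_columns u w) (varX ^ n * varY ^ CARD('p)) =
    linear_form u ^ n * (const2 (w$1) * varX ^ CARD('p) + const2 (w$2) * varY ^ CARD('p))"
  by (simp only: mat_act.hom_mult mat_act_frobenius)
    (simp add: mat_act.hom_power mat_act_simps mat_of_columns_def linear_form_def)

lemma invertible_mat_of_columns: "invertible (mat_of_columns u w) \<longleftrightarrow> u$1 * w$2 \<noteq> w$1 * u$2"
  unfolding invertible_det_nz det_2 by (simp add: mat_of_columns_def)

lemma linear_form_power_card: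
  fixes u :: "'p::prime_card mod_ring^2"
  shows "linear_form u ^ CARD('p) = const2 (u$1) * varX ^ CARD('p) + const2 (u$2) * varY ^ CARD('p)"
proof -
  have "linear_form u ^ CARD('p) = mat_act (mat_of_columns u 0) (varX ^ CARD('p))"
    by (simp add: mat_act.hom_power mat_act_simps mat_of_columns_def linear_form_def)
  thus ?thesis unfolding mat_act_frobenius by (simp add: mat_of_columns_def)
qed


section \<open>Coordinates of binary forms\<close>

definition form :: "nat \<Rightarrow> (nat \<Rightarrow> 'k::field) \<Rightarrow> 'k poly poly" where
  "form n c = (\<Sum>i\<le>n. const2 (c i) * varX ^ (n - i) * varY ^ i)"

lemma coeff_form:
  "poly.coeff (poly.coeff (form n c) j) i = (if i + j = n then c j else 0)"
proof -
  have "poly.coeff (poly.coeff (form n c) j) i =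
      (\<Sum>l\<le>n. if l = j then (if n - l = i then c l else 0) else 0)"
    unfolding form_def monomial2_eq by (simp add: coeff_sum if_distrib cong: if_cong)
  also have "\<dots> = (if i + j = n then c j else 0)"
    by (subst sum.delta) auto
  finally show ?thesis .
qed

lemma form_eq_iff: "form n c = form n d \<longleftrightarrow> (\<forall>i\<le>n. c i = d i)"
proof
  assume *: "form n c = form n d"
  show "\<forall>i\<le>n. c i = d i"
  proof safe
    fix i assume "i \<le> n"
    thus "c i = d i"
      using coeff_form[of n c i "n - i"] coeff_form[of n d i "n - i"] * by simp
  qed
qed (simp add: form_def)

lemma form_eq_0_iff: "form n c = 0 \<longleftrightarrow> (\<forall>i\<le>n. c i = 0)"
  using form_eq_iff[of n c "\<lambda>_. 0"] by (simp add: form_def)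

lemma binary_forms_eq: "binary_forms n = range (form n)"
proof safe
  fix F :: "'a poly poly" assume F: "F \<in> binary_forms n"
  have "poly.coeff (poly.coeff F j) i =
      poly.coeff (poly.coeff (form n (\<lambda>j. poly.coeff (poly.coeff F j) (n - j))) j) i" for i j
    using F unfolding coeff_form binary_forms_def by auto
  hence "F = form n (\<lambda>j. poly.coeff (poly.coeff F j) (n - j))"
    by (intro poly_eqI) blast
  thus "F \<in> range (form n)" by blast
qed (auto simp: binary_forms_def coeff_form)

lemma linear_form_power:
  "linear_form u ^ n = form n (\<lambda>i. of_nat (n choose i) * (u$1 ^ (n - i) * u$2 ^ i))"
proof -
  have "linear_form u ^ n = (const2 (u$2) * varY + const2 (u$1) * varX) ^ n"
    by (simp add: linear_form_def add.commute)
  also have "\<dots> = form n (\<lambda>i. of_nat (n choose i) * (u$1 ^ (n - i) * u$2 ^ i))"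
    unfolding binomial_ring form_def
    by (intro sum.cong) (simp_all add: hom_distribs power_mult_distrib mult_ac)
  finally show ?thesis .
qed

lemma varY_power_dvd_iff: "varY ^ m dvd F \<longleftrightarrow> (\<forall>j<m. poly.coeff F j = 0)"
proof -
  have "varY ^ m = (Polynomial.monom 1 m :: 'a poly poly)"
    unfolding varY_def by (metis monom_altdef smult_1_left)
  thus ?thesis by (simp add: monom_1_dvd_iff')
qed

lemma varY_power_dvd_form_imp_eq_0:
  assumes "varY ^ Suc n dvd form n c"
  shows "form n c = 0"
  unfolding form_eq_0_iff
proof (intro allI impI)
  fix i assume "i \<le> n"
  hence "poly.coeff (form n c) i = 0" using assms unfolding varY_power_dvd_iff by simp
  thus "c i = 0" using coeff_form[of n c i "n - i"] \<open>i \<le> n\<close> by simp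
qed

lemma varX_power_mult_form: "varX ^ m * form n c = form (n + m) (\<lambda>i. if i \<le> n then c i else 0)"
proof -
  have "form (n + m) (\<lambda>i. if i \<le> n then c i else 0) =
      (\<Sum>i\<le>n. const2 (c i) * varX ^ (n + m - i) * varY ^ i)"
    unfolding form_def by (rule sum.mono_neutral_cong_right) auto
  also have "\<dots> = (\<Sum>i\<le>n. varX ^ m * (const2 (c i) * varX ^ (n - i) * varY ^ i))"
  proof (intro sum.cong refl)
    fix i assume "i \<in> {..n}"
    hence "n + m - i = m + (n - i)" by simp
    thus "const2 (c i) * varX ^ (n + m - i) * varY ^ i =
        varX ^ m * (const2 (c i) * varX ^ (n - i) * varY ^ i)"
      by (simp add: power_add mult_ac)
  qed
  finally show ?thesis by (simp add: form_def sum_distrib_left)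
qed

lemma varY_power_mult_form: "varY ^ m * form n c = form (n + m) (\<lambda>i. if m \<le> i then c (i - m) else 0)"
proof -
  have split: "varY ^ m * varY ^ (i - m) = (varY ^ i :: 'a poly poly)" if "m \<le> i" for i
    using that by (simp flip: power_add)
  have "form (n + m) (\<lambda>i. if m \<le> i then c (i - m) else 0) =
      (\<Sum>i\<in>{m..n+m}. const2 (c (i - m)) * varX ^ (n + m - i) * varY ^ i)"
    unfolding form_def by (rule sum.mono_neutral_cong_right) auto
  also have "\<dots> = (\<Sum>i\<le>n. varY ^ m * (const2 (c i) * varX ^ (n - i) * varY ^ i))"
    by (rule sum.reindex_bij_witness[of _ "\<lambda>i. i + m" "\<lambda>i. i - m"])
      (auto simp: split mult_ac)
  finally show ?thesis by (simp add: form_def sum_distrib_left)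
qed

lemma binary_forms_1: "binary_forms 1 = range linear_form"
proof -
  have "form 1 c = linear_form (\<chi> i. if i = 1 then c 0 else c 1)" for c :: "nat \<Rightarrow> 'a"
    by (simp add: form_def linear_form_def)
  moreover have "linear_form u = form 1 (\<lambda>i. if i = 0 then u$1 else u$2)" for u :: "'a^2"
    by (simp add: form_def linear_form_def)
  ultimately show ?thesis unfolding binary_forms_eq by (auto simp: image_iff)
qed

lemma linear_form_add: "linear_form u + linear_form w = linear_form (u + w)"
  by (simp add: linear_form_def hom_distribs algebra_simps)

lemma linear_form_scale: "scale2 c (linear_form u) = linear_form (c *s u)"
  by (simp add: linear_form_def scale2_def hom_distribs algebra_simps)

lemma M_module_det_twist:
  assumes "M_module scale2 V mat_act"
  shows "M_module scale2 V (det_twist scale2 k mat_act)"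
proof -
  interpret M_module scale2 V mat_act by fact
  show ?thesis
    using V_subspace act_closed
    by unfold_locales
      (auto simp: det_twist_def mat_act.hom_add mat_act_scale2 mat_act_one mat_act_mult det_mul
        scale2.subspace_scale scale2.scale_right_distrib power_mult_distrib mult_ac)
qed

lemma M_module_binary_forms_1: "M_module scale2 (binary_forms 1) mat_act"
  unfolding binary_forms_1
proof (rule M_module_mat_act)
  have "0 = linear_form (0 :: 'a^2)" by (simp add: linear_form_def)
  thus "scale2.subspace (range (linear_form :: 'a^2 \<Rightarrow> _))"
    by (intro scale2.subspaceI) (auto simp: linear_form_add linear_form_scale)
qed (auto simp: mat_act_linear_form)


section \<open>Weighted sums of powers of linear forms\<close>

definition moment :: "('p::prime_card mod_ring^2 \<Rightarrow> 'p mod_ring) \<Rightarrow> nat \<Rightarrow> nat \<Rightarrow> 'p mod_ring" where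
  "moment w a b = (\<Sum>u\<in>UNIV. w u * (u$1 ^ a * u$2 ^ b))"

text \<open>
  Elements of the span of the \<open>n\<close>-th powers are handled through their weights \<open>w\<close>, which are not
  unique. The same weights can be used for another exponent, and matrices act on them in a way that
  does not involve \<open>n\<close>.
\<close>
definition power_form ::
  "nat \<Rightarrow> ('p::prime_card mod_ring^2 \<Rightarrow> 'p mod_ring) \<Rightarrow> 'p mod_ring poly poly" where
  "power_form n w = (\<Sum>u\<in>UNIV. const2 (w u) * linear_form u ^ n)"

lemma form_sum: "(\<Sum>u\<in>U. const2 (w u) * form n (c u)) = form n (\<lambda>i. \<Sum>u\<in>U. w u * c u i)"
  unfolding form_def
  by (simp add: sum_distrib_left sum_distrib_right hom_distribs mult_ac, subst sum.swap, rule refl)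

lemma power_form_eq:
  "power_form n w = form n (\<lambda>i. of_nat (n choose i) * moment w (n - i) i)"
  unfolding power_form_def linear_form_power form_sum moment_def
  by (simp add: sum_distrib_left mult_ac)

text \<open>
  The function \<open>x \<mapsto> x\<^sup>a\<close> on the field depends only on \<open>a\<close> modulo \<open>p - 1\<close>, except that \<open>a = 0\<close>
  differs from the positive multiples of \<open>p - 1\<close> at \<open>x = 0\<close>. This is the only reason why different
  exponents \<open>n\<close> can be compared.
\<close>
lemma moment_cong:
  fixes w :: "'p::prime_card mod_ring^2 \<Rightarrow> 'p mod_ring"
  assumes "[a = a'] (mod (CARD('p) - 1))" "a > 0 \<longleftrightarrow> a' > 0"
    and "[b = b'] (mod (CARD('p) - 1))" "b > 0 \<longleftrightarrow> b' > 0"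
  shows "moment w a b = moment w a' b'"
proof -
  have "x ^ a = x ^ a'" "x ^ b = x ^ b'" for x :: "'p mod_ring"
    using assms power_eq_if_cong[of a a' x] power_eq_if_cong[of b b' x]
    by (metis gr0I power_0)+
  thus ?thesis unfolding moment_def by simp
qed

lemma moment_one:
  "moment (\<lambda>_. 1 :: 'p::prime_card mod_ring) a b =
     (if a > 0 \<and> b > 0 \<and> (CARD('p) - 1) dvd a \<and> (CARD('p) - 1) dvd b then 1 else 0)"
  unfolding moment_def
  by (subst sum_vec2) (simp add: power_sum_mod_ring flip: sum_distrib_left sum_distrib_right)

text \<open>
  The matrix pushes the weights forward along \<open>u \<mapsto> A u\<close>.
\<close>
lemma mat_act_power_form:
  "mat_act A (power_form n w) = power_form n (\<lambda>v. \<Sum>u | A *v u = v. w u)"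
proof -
  have "mat_act A (power_form n w) = (\<Sum>u\<in>UNIV. const2 (w u) * linear_form (A *v u) ^ n)"
    by (simp add: power_form_def hom_distribs mat_act_simps mat_act_linear_form)
  also have "\<dots> = (\<Sum>v\<in>UNIV. \<Sum>u | A *v u = v. const2 (w u) * linear_form (A *v u) ^ n)"
    using sum.group[of UNIV UNIV "\<lambda>u. A *v u" "\<lambda>u. const2 (w u) * linear_form (A *v u) ^ n"] by simp
  also have "\<dots> = power_form n (\<lambda>v. \<Sum>u | A *v u = v. w u)"
    unfolding power_form_def hom_distribs sum_distrib_right
    by (intro sum.cong) auto
  finally show ?thesis .
qed

lemma power_form_add: "power_form n v + power_form n w = power_form n (\<lambda>u. v u + w u)"
  by (simp add: power_form_def hom_distribs sum.distrib algebra_simps)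

lemma power_form_scale: "const2 c * power_form n w = power_form n (\<lambda>u. c * w u)"
  by (simp add: power_form_def hom_distribs sum_distrib_left mult_ac)

lemma power_form_diff: "power_form n v - power_form n w = power_form n (\<lambda>u. v u - w u)"
  by (simp add: power_form_def hom_distribs sum_subtractf algebra_simps)

lemma power_form_single: "power_form n (\<lambda>u. if u = v then c else 0) = const2 c * linear_form v ^ n"
proof -
  have "power_form n (\<lambda>u. if u = v then c else 0) =
      (\<Sum>u\<in>UNIV. if u = v then const2 c * linear_form u ^ n else 0)"
    unfolding power_form_def by (intro sum.cong) auto
  thus ?thesis by simp
qed


section \<open>Comparing the exponents \<open>n\<close> and \<open>p - 1\<close>\<close>

lemma power_form_eq_0_iff:
  "power_form n w = 0 \<longleftrightarrow> (\<forall>i\<le>n. of_nat (n choose i) * moment w (n - i) i = 0)"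
  unfolding power_form_eq form_eq_0_iff ..

lemma moment_reduce:
  fixes w :: "'p::prime_card mod_ring^2 \<Rightarrow> 'p mod_ring"
  assumes "(CARD('p) - 1) dvd n" "[i = j] (mod (CARD('p) - 1))"
    and "0 < i" "i < n" "0 < j" "j < CARD('p) - 1"
  shows "moment w (n - i) i = moment w (CARD('p) - 1 - j) j"
proof (rule moment_cong)
  have "[n = CARD('p) - 1] (mod (CARD('p) - 1))"
    using assms(1) by (simp add: cong_def)
  thus "[n - i = CARD('p) - 1 - j] (mod (CARD('p) - 1))"
    using assms by (intro cong_diff_nat) auto
qed (use assms in auto)

lemma moment_ends:
  fixes w :: "'p::prime_card mod_ring^2 \<Rightarrow> 'p mod_ring"
  assumes "(CARD('p) - 1) dvd n" "n > 0" "CARD('p) > 2"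
  shows "moment w n 0 = moment w (CARD('p) - 1) 0" "moment w 0 n = moment w 0 (CARD('p) - 1)"
  by (rule moment_cong; use assms in \<open>auto simp: cong_def\<close>)+

text \<open>
  Each moment that occurs at exponent \<open>p - 1\<close> also occurs at exponent \<open>n\<close> with a binomial coefficient
  prime to \<open>p\<close>: the two extreme ones at \<open>i = 0\<close> and \<open>i = n\<close>, the others because the digit sum of
  \<open>n\<close> is at least \<open>p - 1\<close>.
\<close>
lemma power_form_reduce:
  fixes w :: "'p::prime_card mod_ring^2 \<Rightarrow> 'p mod_ring"
  assumes n: "(CARD('p) - 1) dvd n" "n > 0" and p: "CARD('p) > 2" and 0: "power_form n w = 0"
  shows "power_form (CARD('p) - 1) w = 0"
  unfolding power_form_eq_0_iff
proof (intro allI impI)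
  fix j assume j: "j \<le> CARD('p) - 1"
  have c: "of_nat (n choose i) * moment w (n - i) i = 0" if "i \<le> n" for i
    using 0 that unfolding power_form_eq_0_iff by blast
  have "moment w (CARD('p) - 1 - j) j = 0"
  proof -
    consider "j = 0" | "j = CARD('p) - 1" | "0 < j" "j < CARD('p) - 1" using j by linarith
    thus ?thesis
    proof cases
      case 1
      thus ?thesis using c[of 0] moment_ends[OF n p, of w] by simp
    next
      case 2
      thus ?thesis using c[of n] moment_ends[OF n p, of w] by simp
    next
      case 3
      have "j < digit_sum CARD('p) n"
        using digit_sum_ge[OF prime_card[where 'a = 'p] n(2,1)] 3 by linarith
      then obtain i where i: "0 < i" "i < n" "[i = j] (mod (CARD('p) - 1))"
        "\<not> CARD('p) dvd (n choose i)"
        using ex_binomial_not_dvd[OF prime_card[where 'a = 'p], of j n] 3 by blast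
      have "moment w (n - i) i = 0"
        using c[of i] i by (simp add: of_nat_binomial_eq_0_iff)
      thus ?thesis using moment_reduce[OF n(1) i(3,1,2) 3] by simp
    qed
  qed
  thus "of_nat (CARD('p) - 1 choose j) * moment w (CARD('p) - 1 - j) j = 0" by simp
qed

lemma moment_eq_0_if_power_form_eq_0:
  fixes w :: "'p::prime_card mod_ring^2 \<Rightarrow> 'p mod_ring"
  assumes "power_form (CARD('p) - 1) w = 0" "j \<le> CARD('p) - 1"
  shows "moment w (CARD('p) - 1 - j) j = 0"
proof -
  have "of_nat (CARD('p) - 1 choose j) * moment w (CARD('p) - 1 - j) j = 0"
    using assms unfolding power_form_eq_0_iff by blast
  thus ?thesis using not_dvd_binomial_pred[OF prime_card[where 'a = 'p] assms(2)]
    by (simp add: of_nat_binomial_eq_0_iff del: One_nat_def)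
qed

text \<open>
  If all moments at exponent \<open>p - 1\<close> vanish, only the moment with both exponents positive multiples
  of \<open>p - 1\<close> can survive at exponent \<open>n\<close>. The constant weight \<open>1\<close> has exactly this moment, with
  value \<open>(-1)(-1) = 1\<close>.
\<close>
lemma power_form_of_kernel:
  fixes w :: "'p::prime_card mod_ring^2 \<Rightarrow> 'p mod_ring"
  assumes n: "(CARD('p) - 1) dvd n" "n > 0" and p: "CARD('p) > 2"
    and 0: "power_form (CARD('p) - 1) w = 0"
  shows "power_form n w =
    const2 (moment w (CARD('p) - 1) (CARD('p) - 1)) * power_form n (\<lambda>_. 1)"
  unfolding power_form_scale unfolding power_form_eq form_eq_iff
proof (intro allI impI)
  fix i assume i: "i \<le> n"
  define \<kappa> where "\<kappa> = moment w (CARD('p) - 1) (CARD('p) - 1)"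
  note z = moment_eq_0_if_power_form_eq_0[OF 0]
  have one: "moment (\<lambda>_. \<kappa> * 1) a b = \<kappa> * moment (\<lambda>_. 1) a b" for a b
    unfolding moment_def by (simp add: sum_distrib_left)
  have "moment w (n - i) i = \<kappa> * moment (\<lambda>_. 1) (n - i) i"
  proof -
    consider "i = 0" | "i = n" | "0 < i" "i < n" "\<not> (CARD('p) - 1) dvd i"
      | "0 < i" "i < n" "(CARD('p) - 1) dvd i" using i by linarith
    thus ?thesis
    proof cases
      case 1
      thus ?thesis using z[of 0] moment_ends[OF n p, of w] by (simp add: moment_one)
    next
      case 2
      thus ?thesis using z[of "CARD('p) - 1"] moment_ends[OF n p, of w] by (simp add: moment_one)
    next
      case 3
      define j where "j = i mod (CARD('p) - 1)"
      have j: "0 < j" "j < CARD('p) - 1" "[i = j] (mod (CARD('p) - 1))"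
        using 3 p unfolding j_def by (auto simp: mod_greater_zero_iff_not_dvd cong_def)
      show ?thesis using moment_reduce[OF n(1) j(3) 3(1,2) j(1,2), of w] z[of j] j 3
        by (simp add: moment_one)
    next
      case 4
      have "moment w (n - i) i = \<kappa>" unfolding \<kappa>_def
        by (rule moment_cong) (use 4 n p in \<open>auto simp: cong_def dvd_imp_mod_0 dvd_diff_nat\<close>)
      thus ?thesis using 4 n by (simp add: moment_one dvd_diff_nat)
    qed
  qed
  thus "of_nat (n choose i) * moment w (n - i) i = of_nat (n choose i) *
      moment (\<lambda>_. moment w (CARD('p) - 1) (CARD('p) - 1) * 1) (n - i) i"
    unfolding one[unfolded \<kappa>_def] \<kappa>_def by simp
qed

lemma power_form_one_eq_0_iff:
  assumes n: "(CARD('p::prime_card) - 1) dvd n" "n > 0"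
  shows "power_form n (\<lambda>_ :: 'p mod_ring^2. 1) = 0 \<longleftrightarrow> digit_sum CARD('p) n = CARD('p) - 1"
proof
  assume 0: "power_form n (\<lambda>_ :: 'p mod_ring^2. 1) = 0"
  show "digit_sum CARD('p) n = CARD('p) - 1"
  proof (rule ccontr)
    assume "digit_sum CARD('p) n \<noteq> CARD('p) - 1"
    hence "CARD('p) - 1 < digit_sum CARD('p) n"
      using digit_sum_ge[OF prime_card[where 'a = 'p] n(2,1)] by linarith
    moreover have "CARD('p) - 1 > 0" using prime_gt_1_nat[OF prime_card[where 'a = 'p]] by simp
    ultimately obtain i where i: "0 < i" "i < n" "[i = CARD('p) - 1] (mod (CARD('p) - 1))"
        "\<not> CARD('p) dvd (n choose i)"
      using ex_binomial_not_dvd[OF prime_card[where 'a = 'p], of "CARD('p) - 1" n] by blast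
    have "(CARD('p) - 1) dvd i" using i(3) by (simp add: cong_def mod_eq_0_iff_dvd)
    hence "moment (\<lambda>_ :: 'p mod_ring^2. 1) (n - i) i = 1"
      using i n by (simp add: moment_one dvd_diff_nat)
    moreover have "of_nat (n choose i) * moment (\<lambda>_ :: 'p mod_ring^2. 1) (n - i) i = 0"
      using 0 i unfolding power_form_eq_0_iff by (meson less_imp_le)
    ultimately show False using i(4) by (simp add: of_nat_binomial_eq_0_iff)
  qed
next
  assume s: "digit_sum CARD('p) n = CARD('p) - 1"
  show "power_form n (\<lambda>_ :: 'p mod_ring^2. 1) = 0"
    unfolding power_form_eq_0_iff
  proof (intro allI impI)
    fix i assume "i \<le> n"
    show "of_nat (n choose i) * moment (\<lambda>_ :: 'p mod_ring^2. 1) (n - i) i = 0"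
    proof (cases "0 < i \<and> i < n \<and> (CARD('p) - 1) dvd i")
      case True
      hence "CARD('p) dvd (n choose i)"
        using dvd_binomial_if_digit_sum_minimal[OF prime_card[where 'a = 'p] s n(1)] by blast
      thus ?thesis using of_nat_binomial_eq_0_iff[where 'p = 'p] by simp
    next
      case False
      thus ?thesis using \<open>i \<le> n\<close> by (auto simp: moment_one)
    qed
  qed
qed

text \<open>
  An invertible matrix permutes the vectors \<open>u\<close>. For a singular matrix with \<open>A d = 0\<close> the summand
  \<open>\<ell>\<^bsub>Au\<^esub>\<^sup>n\<close> is constant along the direction \<open>d\<close>, so the sum vanishes, as does \<open>det A\<close>.
\<close>
lemma mat_act_power_form_one:
  fixes A :: "'p::prime_card mod_ring^2^2"
  assumes "n > 0"
  shows "mat_act A (power_form n (\<lambda>_. 1)) = const2 (det A ^ (CARD('p) - 1)) * power_form n (\<lambda>_. 1)"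
proof -
  have p1: "CARD('p) > 1" using prime_gt_1_nat[OF prime_card[where 'a = 'p]] .
  have act: "mat_act A (power_form n (\<lambda>_. 1)) = (\<Sum>u\<in>UNIV. linear_form (A *v u) ^ n)"
    by (simp add: power_form_def hom_distribs mat_act_linear_form)
  show ?thesis
  proof (cases "invertible A")
    case True
    then obtain B where B: "A ** B = mat 1" "B ** A = mat 1" unfolding invertible_def by blast
    have "(\<Sum>u\<in>UNIV. linear_form (A *v u) ^ n) = (\<Sum>u\<in>UNIV. linear_form u ^ n)"
      by (rule sum.reindex_bij_witness[of _ "\<lambda>u. B *v u" "\<lambda>u. A *v u"])
        (simp_all add: matrix_vector_mul_assoc B)
    moreover have "det A \<noteq> 0" using True invertible_det_nz by blast
    ultimately show ?thesis unfolding act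
      using fermat_mod_ring[of "det A"] by (simp add: power_form_def)
  next
    case False
    hence "\<not> (\<exists>B. B ** A = mat 1)" by (simp add: invertible_left_inverse)
    then obtain d where d: "A *v d = 0" "d \<noteq> 0" unfolding matrix_left_invertible_ker by blast
    have "(\<Sum>u\<in>UNIV. linear_form (A *v u) ^ n) = 0"
    proof (rule sum_translation_invariant_eq_0[OF _ d(2)])
      have "(of_nat CARD('p) :: 'p mod_ring poly poly) = of_nat CHAR('p mod_ring poly poly)" by simp
      thus "of_nat CARD('p) = (0 :: 'p mod_ring poly poly)" using of_nat_CHAR by metis
    qed (simp add: matrix_vector_right_distrib vector_scalar_commute d)
    moreover have "det A = 0" using False invertible_det_nz by blast
    ultimately show ?thesis unfolding act using p1 by (simp add: power_0_left)
  qed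
qed


section \<open>Independence over \<open>X\<^sup>p\<close> and \<open>Y\<^sup>p\<close>\<close>

text \<open>
  The coefficient of \<open>Y\<^sup>n\<close> in the sheared form is \<open>\<Sum>\<^sub>u v(u) (t u\<^sub>1 + u\<^sub>2)\<^bsup>p-1\<^esup>\<close>. As a function of
  \<open>t\<close> this is a polynomial of degree below \<open>p\<close>, whose coefficients are the moments up to units. If
  it is constant on the whole field, all coefficients but the constant one vanish.
\<close>
lemma shear_invariant_moments:
  fixes v :: "'p::prime_card mod_ring^2 \<Rightarrow> 'p mod_ring"
  assumes n: "(CARD('p) - 1) dvd n" "n > 0" and p: "CARD('p) > 2"
    and inv: "\<And>t. mat_act (shear t) (power_form n v) = power_form n v"
    and k: "0 < k" "k \<le> CARD('p) - 1"
  shows "moment v k (CARD('p) - 1 - k) = 0"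
proof -
  define q where "q = CARD('p) - 1"
  have qn: "x ^ n = x ^ q" for x :: "'p mod_ring"
    by (rule power_eq_if_cong) (use n p in \<open>auto simp: cong_def q_def\<close>)
  have const: "(\<Sum>u\<in>UNIV. v u * (t * u$1 + u$2) ^ q) = moment v 0 q" for t
  proof -
    have "mat_act (shear t) (power_form n v) = (\<Sum>u\<in>UNIV. const2 (v u) * linear_form (shear t *v u) ^ n)"
      by (simp add: power_form_def hom_distribs mat_act_simps mat_act_linear_form)
    also have "\<dots> = form n (\<lambda>i. \<Sum>u\<in>UNIV. v u * (of_nat (n choose i) *
        ((shear t *v u)$1 ^ (n - i) * (shear t *v u)$2 ^ i)))"
      unfolding linear_form_power form_sum ..
    finally have "form n (\<lambda>i. \<Sum>u\<in>UNIV. v u * (of_nat (n choose i) *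
        ((shear t *v u)$1 ^ (n - i) * (shear t *v u)$2 ^ i))) =
        form n (\<lambda>i. of_nat (n choose i) * moment v (n - i) i)"
      using inv[of t] unfolding power_form_eq[symmetric] by simp
    hence "(\<Sum>u\<in>UNIV. v u * (of_nat (n choose n) *
        ((shear t *v u)$1 ^ (n - n) * (shear t *v u)$2 ^ n))) =
        of_nat (n choose n) * moment v (n - n) n"
      unfolding form_eq_iff by blast
    hence "(\<Sum>u\<in>UNIV. v u * (t * u$1 + u$2) ^ n) = moment v 0 n"
      by (simp add: matrix_vector_mult_def sum_2)
    thus ?thesis unfolding qn moment_def .
  qed
  define f where "f = (\<Sum>k\<le>q. Polynomial.monom (of_nat (q choose k) * moment v k (q - k)) k)
    - [:moment v 0 q:]"
  have "poly f t = 0" for t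
  proof -
    have "(\<Sum>u\<in>UNIV. v u * (t * u$1 + u$2) ^ q) =
        (\<Sum>u\<in>UNIV. \<Sum>k\<le>q. of_nat (q choose k) * (v u * (u$1 ^ k * u$2 ^ (q - k))) * t ^ k)"
      by (intro sum.cong refl)
        (simp add: binomial_ring sum_distrib_left power_mult_distrib mult_ac)
    also have "\<dots> = (\<Sum>k\<le>q. of_nat (q choose k) * moment v k (q - k) * t ^ k)"
      by (subst sum.swap) (simp add: moment_def sum_distrib_left sum_distrib_right)
    finally show ?thesis using const[of t] by (simp add: f_def poly_sum poly_monom)
  qed
  moreover have "degree f < CARD('p)"
  proof -
    have "degree f \<le> q" unfolding f_def
      by (intro degree_diff_le degree_sum_le) (auto intro: order_trans[OF degree_monom_le])
    thus ?thesis using p unfolding q_def by simp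
  qed
  ultimately have "f = 0" by (intro poly_eq_0_if_vanishes_mod_ring) auto
  hence "poly.coeff f k = 0" by simp
  moreover have "poly.coeff f k = of_nat (q choose k) * moment v k (q - k)"
    using k unfolding f_def q_def
    by (cases k) (simp_all add: coeff_sum coeff_pCons)
  moreover have "of_nat (q choose k) \<noteq> (0 :: 'p mod_ring)"
    using not_dvd_binomial_pred[OF prime_card[where 'a = 'p] k(2)]
    by (simp add: of_nat_binomial_eq_0_iff q_def del: One_nat_def)
  ultimately show ?thesis by (simp add: q_def)
qed

text \<open>
  Let \<open>c\<^sub>i\<close> and \<open>d\<^sub>i\<close> be the coefficients of \<open>X\<^bsup>n-i\<^esup> Y\<^bsup>i\<^esup>\<close> in the two forms; the relation says
  \<open>d\<^sub>i = c\<^bsub>i+p\<^esub>\<close>. Invariance kills \<open>c\<^sub>i\<close> unless \<open>p - 1\<close> divides \<open>i\<close>, so \<open>d\<^sub>i\<close> vanishes unless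
  \<open>i \<equiv> -1\<close> modulo \<open>p - 1\<close>. For these \<open>i\<close> the moment in \<open>d\<^sub>i\<close> is the one in \<open>d\<^bsub>n-1\<^esub>\<close>. Now
  \<open>d\<^bsub>n-1\<^esub> = c\<^bsub>n-1+p\<^esub> = 0\<close> and its binomial coefficient is \<open>n\<close>, which is nonzero modulo \<open>p\<close>.
\<close>
lemma shear_invariant_syzygy_trivial:
  fixes v w :: "'p::prime_card mod_ring^2 \<Rightarrow> 'p mod_ring"
  assumes n: "(CARD('p) - 1) dvd n" "n > 0" and pn: "\<not> CARD('p) dvd n" and p: "CARD('p) > 2"
    and inv: "\<And>t. mat_act (shear t) (power_form n v) = power_form n v"
    and syz: "varX ^ CARD('p) * power_form n v = varY ^ CARD('p) * power_form n w"
  shows "power_form n v = 0"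
proof -
  define c where "c i = of_nat (n choose i) * moment v (n - i) i" for i
  define d where "d i = of_nat (n choose i) * moment w (n - i) i" for i
  have "(if i \<le> n then c i else 0) = (if CARD('p) \<le> i then d (i - CARD('p)) else 0)"
    if "i \<le> n + CARD('p)" for i
    using syz that
    unfolding power_form_eq varX_power_mult_form varY_power_mult_form form_eq_iff c_def d_def
    by blast
  note rel = this
  have shift: "d i = (if i + CARD('p) \<le> n then c (i + CARD('p)) else 0)" if "i \<le> n" for i
    using rel[of "i + CARD('p)"] that by simp
  have c0: "c i = 0" if i: "i \<le> n" "\<not> (CARD('p) - 1) dvd i" for i
  proof -
    define j where "j = i mod (CARD('p) - 1)"
    have "0 < i" "i < n" using i n by (auto intro!: Nat.gr0I le_neq_trans)
    have j: "0 < j" "j < CARD('p) - 1" "[i = j] (mod (CARD('p) - 1))"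
      using i p unfolding j_def by (auto simp: mod_greater_zero_iff_not_dvd cong_def)
    have "moment v (n - i) i = moment v (CARD('p) - 1 - j) j"
      by (rule moment_reduce[OF n(1) j(3) \<open>0 < i\<close> \<open>i < n\<close> j(1,2)])
    also have "\<dots> = 0"
      using shear_invariant_moments[OF n p inv, of "CARD('p) - 1 - j"] j by simp
    finally show ?thesis unfolding c_def by simp
  qed
  have d0: "d i = 0" if i: "i \<le> n" for i
  proof (cases "(CARD('p) - 1) dvd Suc i")
    case False
    have eq: "i + CARD('p) = Suc i + (CARD('p) - 1)" using p by simp
    have "\<not> (CARD('p) - 1) dvd (i + CARD('p))" unfolding eq dvd_add_triv_right_iff by (rule False)
    thus ?thesis using shift[OF i] c0[of "i + CARD('p)"] by auto
  next
    case True
    have not1: "\<not> (CARD('p) - 1) dvd 1" using p by simp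
    have "i \<noteq> n" using True n(1) not1 by (metis Suc_eq_plus1 dvd_add_right_iff)
    have "i \<noteq> 0" using True not1 by (metis One_nat_def)
    have n1: "n > 1" using \<open>i \<noteq> n\<close> \<open>i \<noteq> 0\<close> i by linarith
    have "d (n - 1) = 0" using shift[of "n - 1"] p by simp
    moreover have "of_nat (n choose (n - 1)) \<noteq> (0 :: 'p mod_ring)"
      using pn n binomial_symmetric[of 1 n] unfolding of_nat_binomial_eq_0_iff by simp
    ultimately have "moment w 1 (n - 1) = 0" unfolding d_def using n by simp
    moreover have "moment w (n - i) i = moment w 1 (n - 1)"
    proof (rule moment_cong)
      have *: "[Suc i = n] (mod (CARD('p) - 1))"
        using True n(1) by (simp add: cong_def dvd_imp_mod_0)
      have "[Suc i - 1 = n - 1] (mod (CARD('p) - 1))"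
        using * n by (intro cong_diff_nat) auto
      thus "[i = n - 1] (mod (CARD('p) - 1))" by simp
      have "[n + 1 - Suc i = n + 1 - n] (mod (CARD('p) - 1))"
        using * i by (intro cong_diff_nat) auto
      thus "[n - i = 1] (mod (CARD('p) - 1))" by simp
    qed (use \<open>i \<noteq> n\<close> \<open>i \<noteq> 0\<close> i n1 in auto)
    ultimately show ?thesis unfolding d_def by simp
  qed
  have "power_form n w = 0" unfolding power_form_eq_0_iff using d0 unfolding d_def by blast
  hence "varX ^ CARD('p) * power_form n v = 0" using syz by simp
  thus ?thesis by (simp add: varX_def)
qed

text \<open>
  Reduction to the shear-invariant case, by induction on the number \<open>m\<close> of powers of \<open>Y\<close> still
  missing for \<open>f\<close> to be divisible by \<open>Y\<^bsup>n+1\<^esup>\<close> and hence zero. If \<open>(f, g)\<close> is a relation and \<open>T\<close> the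
  shear by \<open>t\<close>, applying \<open>T\<close> gives \<open>(X\<^sup>p + t Y\<^sup>p) T f = Y\<^sup>p T g\<close>. So \<open>(T f - f, T g - t T f - g)\<close>
  is again a relation, and its first entry is divisible by one more \<open>Y\<close>.
\<close>
lemma syzygy_trivial:
  fixes v w :: "'p::prime_card mod_ring^2 \<Rightarrow> 'p mod_ring"
  assumes n: "(CARD('p) - 1) dvd n" "n > 0" and pn: "\<not> CARD('p) dvd n" and p: "CARD('p) > 2"
    and syz: "varX ^ CARD('p) * power_form n v = varY ^ CARD('p) * power_form n w"
  shows "power_form n v = 0"
proof -
  have "power_form n v = 0" if "m \<le> Suc n" "varY ^ (Suc n - m) dvd power_form n v"
    "varX ^ CARD('p) * power_form n v = varY ^ CARD('p) * power_form n w"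
    for m and v w :: "'p mod_ring^2 \<Rightarrow> 'p mod_ring"
    using that
  proof (induction m arbitrary: v w)
    case 0
    thus ?case unfolding power_form_eq by (intro varY_power_dvd_form_imp_eq_0) simp
  next
    case (Suc m)
    define k where "k = Suc n - Suc m"
    have k: "Suc n - m = Suc k" using Suc.prems(1) unfolding k_def by simp
    have "mat_act (shear t) (power_form n v) = power_form n v" for t
    proof -
      define T where "T = mat_act (shear t)"
      obtain h where h: "power_form n v = varY ^ k * h" using Suc.prems(2) unfolding k_def by (elim dvdE)
      have "T (power_form n v) - power_form n v = varY ^ k * (T h - h)"
        unfolding h T_def by (simp add: hom_distribs mat_act_shear algebra_simps)
      hence "varY ^ (Suc n - m) dvd T (power_form n v) - power_form n v"
        unfolding k T_def using varY_dvd_shear_diff[of t h]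
        by (metis mult_dvd_mono dvd_refl power_Suc2)
      moreover have "varX ^ CARD('p) * (T (power_form n v) - power_form n v) =
          varY ^ CARD('p) * (T (power_form n w) - const2 t * T (power_form n v) - power_form n w)"
      proof -
        have "T (varX ^ CARD('p) * power_form n v) = T (varY ^ CARD('p) * power_form n w)"
          using Suc.prems(3) by simp
        hence "(varX ^ CARD('p) + const2 t * varY ^ CARD('p)) * T (power_form n v) =
            varY ^ CARD('p) * T (power_form n w)"
          unfolding T_def mat_act.hom_mult mat_act_frobenius by simp
        thus ?thesis using Suc.prems(3) by (simp add: algebra_simps)
      qed
      ultimately have "T (power_form n v) - power_form n v = 0"
        using Suc.IH Suc.prems(1)
        unfolding T_def mat_act_power_form power_form_diff power_form_scale by simp
      thus ?thesis unfolding T_def by simp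
    qed
    thus ?case using shear_invariant_syzygy_trivial[OF n pn p _ Suc.prems(3)] by blast
  qed
  from this[of "Suc n" v w] show ?thesis using syz by simp
qed


section \<open>The modules spanned by products with \<open>X\<^sup>p\<close> and \<open>Y\<^sup>p\<close>\<close>

definition pair_form ::
  "nat \<Rightarrow> ('p::prime_card mod_ring^2 \<Rightarrow> 'p mod_ring) \<Rightarrow> ('p mod_ring^2 \<Rightarrow> 'p mod_ring)
    \<Rightarrow> 'p mod_ring poly poly" where
  "pair_form n v w = varX ^ CARD('p) * power_form n v + varY ^ CARD('p) * power_form n w"

lemma pair_form_eq_0:
  fixes v w :: "'p::prime_card mod_ring^2 \<Rightarrow> 'p mod_ring"
  assumes n: "(CARD('p) - 1) dvd n" "n > 0" and pn: "\<not> CARD('p) dvd n" and p: "CARD('p) > 2"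
    and 0: "pair_form n v w = 0"
  shows "power_form n v = 0 \<and> power_form n w = 0"
proof -
  have "power_form n (\<lambda>u. - 1 * w u) = - power_form n w"
    using power_form_scale[of "- 1" n w] by (simp add: hom_distribs)
  hence "varX ^ CARD('p) * power_form n v = varY ^ CARD('p) * power_form n (\<lambda>u. - 1 * w u)"
    using 0 unfolding pair_form_def by (simp add: add_eq_0_iff)
  hence v: "power_form n v = 0" by (rule syzygy_trivial[OF n pn p])
  hence "varY ^ CARD('p) * power_form n w = 0" using 0 unfolding pair_form_def by simp
  thus ?thesis using v by (simp add: varY_def)
qed

lemma pair_form_add:
  "pair_form n v w + pair_form n v' w' = pair_form n (\<lambda>u. v u + v' u) (\<lambda>u. w u + w' u)"
  unfolding pair_form_def power_form_add[symmetric] by (simp add: algebra_simps)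

lemma pair_form_diff:
  "pair_form n v w - pair_form n v' w' = pair_form n (\<lambda>u. v u - v' u) (\<lambda>u. w u - w' u)"
  unfolding pair_form_def power_form_diff[symmetric] by (simp add: algebra_simps)

lemma pair_form_scale: "scale2 c (pair_form n v w) = pair_form n (\<lambda>u. c * v u) (\<lambda>u. c * w u)"
  unfolding pair_form_def power_form_scale[symmetric] scale2_def by (simp add: algebra_simps)

lemma mat_act_pair_form:
  fixes A :: "'p::prime_card mod_ring^2^2"
  shows "mat_act A (pair_form n v w) = pair_form n
    (\<lambda>x. A$1$1 * (\<Sum>u | A *v u = x. v u) + A$1$2 * (\<Sum>u | A *v u = x. w u))
    (\<lambda>x. A$2$1 * (\<Sum>u | A *v u = x. v u) + A$2$2 * (\<Sum>u | A *v u = x. w u))"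
  unfolding pair_form_def mat_act.hom_add mat_act.hom_mult mat_act_frobenius mat_act_power_form
    power_form_add[symmetric] power_form_scale[symmetric]
  by (simp add: algebra_simps)

lemma power_form_mult_linear_form_power:
  fixes u :: "'p::prime_card mod_ring^2"
  shows "power_form n w * linear_form u ^ CARD('p) = pair_form n (\<lambda>x. u$1 * w x) (\<lambda>x. u$2 * w x)"
  unfolding linear_form_power_card pair_form_def power_form_scale[symmetric]
  by (simp add: algebra_simps)

definition pair_forms :: "nat \<Rightarrow> 'p::prime_card mod_ring poly poly set" where
  "pair_forms n = {pair_form n v w | v w. True}"

lemma pair_form_in [simp]: "pair_form n v w \<in> pair_forms n"
  unfolding pair_forms_def by blast

lemma pair_formsE:
  assumes "F \<in> pair_forms n"
  obtains v w where "F = pair_form n v w"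
  using assms unfolding pair_forms_def by blast

lemma subspace_pair_forms: "scale2.subspace (pair_forms n)"
proof (rule scale2.subspaceI)
  have "0 = pair_form n (\<lambda>_. 0) (\<lambda>_. 0)" by (simp add: pair_form_def power_form_def)
  thus "0 \<in> pair_forms n" by (metis pair_form_in)
qed (auto elim!: pair_formsE simp: pair_form_add pair_form_scale)

lemma mat_act_pair_forms: "F \<in> pair_forms n \<Longrightarrow> mat_act A F \<in> pair_forms n"
  by (auto elim!: pair_formsE simp: mat_act_pair_form)

lemma M_module_pair_forms: "M_module scale2 (pair_forms n) mat_act"
  by (intro M_module_mat_act subspace_pair_forms mat_act_pair_forms)

text \<open>
  Matrices with first column \<open>u\<close> produce \<open>\<ell>\<^sub>u\<^sup>n (w\<^sub>1 X\<^sup>p + w\<^sub>2 Y\<^sup>p)\<close> for all \<open>w\<close> independent of \<open>u\<close>.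
  A dependent \<open>w\<close> is the difference of the independent vectors \<open>w + e\<close> and \<open>e\<close>. For \<open>u = 0\<close> the
  product is zero because \<open>n > 0\<close>.
\<close>
lemma power_form_products_in_submodule:
  fixes S :: "'p::prime_card mod_ring poly poly set"
  assumes S: "scale2.subspace S" and inv: "\<And>A F. invertible A \<Longrightarrow> F \<in> S \<Longrightarrow> mat_act A F \<in> S"
    and gen: "varX ^ n * varY ^ CARD('p) \<in> S" and "n > 0"
  shows "linear_form u ^ n * varX ^ CARD('p) \<in> S" "linear_form u ^ n * varY ^ CARD('p) \<in> S"
proof -
  define L where "L w = linear_form u ^ n * (const2 (w$1) * varX ^ CARD('p) + const2 (w$2) * varY ^ CARD('p))"
    for w :: "'p mod_ring^2"
  have L: "L w \<in> S" if "u$1 * w$2 \<noteq> w$1 * u$2" for w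
    using inv[OF _ gen, of "mat_of_columns u w"] that
    unfolding mat_act_mat_of_columns invertible_mat_of_columns L_def by blast
  have "L w \<in> S" for w
  proof (cases "u = 0")
    case True
    hence "L w = 0" using \<open>n > 0\<close> by (simp add: L_def linear_form_def power_0_left)
    thus ?thesis using scale2.subspace_0[OF S] by simp
  next
    case False
    then obtain e :: "'p mod_ring^2" where e: "u$1 * e$2 \<noteq> e$1 * u$2"
    proof (cases "u$1 = 0")
      case True
      hence "u$2 \<noteq> 0" using False by (auto simp: vec_eq_iff forall_2)
      thus ?thesis using that[of "axis 1 1"] by (simp add: axis_def)
    qed (use that[of "axis 2 1"] in \<open>simp add: axis_def\<close>)
    show ?thesis
    proof (cases "u$1 * w$2 = w$1 * u$2")
      case True
      have "u$1 * (w + e)$2 \<noteq> (w + e)$1 * u$2" using True e by (simp add: algebra_simps)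
      hence "L (w + e) - L e \<in> S" using L e scale2.subspace_diff[OF S] by blast
      moreover have "L (w + e) - L e = L w" by (simp add: L_def hom_distribs algebra_simps)
      ultimately show ?thesis by simp
    qed (rule L)
  qed
  from this[of "axis 1 1"] this[of "axis 2 1"]
  show "linear_form u ^ n * varX ^ CARD('p) \<in> S" "linear_form u ^ n * varY ^ CARD('p) \<in> S"
    by (simp_all add: L_def axis_def)
qed

lemma X_module_eq_pair_forms:
  assumes "n > 0"
  shows "X_module n (n + CARD('p)) = (pair_forms n :: 'p::prime_card mod_ring poly poly set)"
proof
  have "pair_form n (\<lambda>_. 0) (\<lambda>u. if u = axis 1 1 then 1 else 0) =
      (varX ^ n * varY ^ CARD('p) :: 'p mod_ring poly poly)"
    unfolding pair_form_def power_form_single by (simp add: linear_form_axis power_form_def)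
  hence "varX ^ n * varY ^ CARD('p) \<in> (pair_forms n :: 'p mod_ring poly poly set)"
    by (metis pair_form_in)
  thus "X_module n (n + CARD('p)) \<subseteq> (pair_forms n :: 'p mod_ring poly poly set)"
    unfolding X_module_def GL_submodule_gen_def
    by (intro hull_minimal) (auto simp: subspace_pair_forms mat_act_pair_forms)
next
  show "(pair_forms n :: 'p mod_ring poly poly set) \<subseteq> X_module n (n + CARD('p))"
    unfolding X_module_def GL_submodule_gen_def hull_def
  proof (intro Inter_greatest subsetI, elim CollectE conjE)
    fix S :: "'p mod_ring poly poly set" and F :: "'p mod_ring poly poly"
    assume S: "scale2.subspace S"
      and inv: "\<forall>A :: 'p mod_ring^2^2. invertible A \<longrightarrow> (\<forall>G\<in>S. mat_act A G \<in> S)"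
      and gen: "{varX ^ n * varY ^ (n + CARD('p) - n)} \<subseteq> S" and F: "F \<in> pair_forms n"
    note prods = power_form_products_in_submodule[OF S, of n, OF _ _ assms]
    have X: "const2 c * (linear_form u ^ n * varX ^ CARD('p)) \<in> S"
      and Y: "const2 c * (linear_form u ^ n * varY ^ CARD('p)) \<in> S" for u c
      using prods[of u] inv gen scale2.subspace_scale[OF S, of _ c] unfolding scale2_def by auto
    obtain v w where "F = pair_form n v w" using F by (elim pair_formsE)
    hence "F = (\<Sum>u\<in>UNIV. const2 (v u) * (linear_form u ^ n * varX ^ CARD('p))) +
        (\<Sum>u\<in>UNIV. const2 (w u) * (linear_form u ^ n * varY ^ CARD('p)))"
      by (simp add: pair_form_def power_form_def sum_distrib_left mult_ac)
    also have "\<dots> \<in> S"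
      by (intro scale2.subspace_add[OF S] scale2.subspace_sum[OF S] X Y)
    finally show "F \<in> S" .
  qed
qed

text \<open>
  The powers \<open>\<ell>\<^sub>u\<^bsup>p-1\<^esup>\<close> span all forms of degree \<open>p - 1\<close>. The monomials \<open>X\<^bsup>p-1\<^esup>\<close> and \<open>Y\<^bsup>p-1\<^esup>\<close>
  are such powers themselves. For \<open>0 < j < p - 1\<close> the weight \<open>u\<^sub>1\<^bsup>j\<^esup> u\<^sub>2\<^bsup>p-1-j\<^esup>\<close> is orthogonal to
  all monomials but the one with index \<open>j\<close>, by the power sums over the field.
\<close>
lemma power_form_surj:
  assumes p: "CARD('p::prime_card) > 2"
  shows "\<exists>w :: 'p mod_ring^2 \<Rightarrow> 'p mod_ring. form (CARD('p) - 1) c = power_form (CARD('p) - 1) w"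
proof -
  define q where "q = CARD('p) - 1"
  have "\<exists>w :: 'p mod_ring^2 \<Rightarrow> 'p mod_ring.
      const2 (c j) * varX ^ (q - j) * varY ^ j = power_form q w" if j: "j \<le> q" for j
  proof -
    consider "j = 0" | "j = q" | "0 < j" "j < q" using j by linarith
    thus ?thesis
    proof cases
      case 1
      thus ?thesis
        by (intro exI[of _ "\<lambda>u. if u = axis 1 1 then c j else 0"])
          (simp add: power_form_single linear_form_axis)
    next
      case 2
      thus ?thesis
        by (intro exI[of _ "\<lambda>u. if u = axis 2 1 then c j else 0"])
          (simp add: power_form_single linear_form_axis)
    next
      case 3
      define w :: "'p mod_ring^2 \<Rightarrow> 'p mod_ring" where "w u = u$1 ^ j * u$2 ^ (q - j)" for u
      have mom: "moment w (q - i) i = (if i = j then 1 else 0)" if i: "i \<le> q" for i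
      proof -
        have "moment w (q - i) i = moment (\<lambda>_. 1) (q - i + j) (q - j + i)"
          unfolding moment_def w_def by (simp add: power_add mult_ac)
        moreover have "i = j" if "q dvd (q - j + i)"
        proof -
          obtain k where k: "q - j + i = q * k" using \<open>q dvd _\<close> by (elim dvdE)
          have "q * k < q * 2" "q * k > 0" using k 3 i by linarith+
          hence "k = 1" by simp
          thus ?thesis using k 3 by simp
        qed
        moreover have "q - i + j > 0" "q - j + i > 0" using 3 i by auto
        ultimately show ?thesis using i j by (auto simp: moment_one q_def)
      qed
      have b: "of_nat (q choose j) \<noteq> (0 :: 'p mod_ring)"
        using not_dvd_binomial_pred[OF prime_card[where 'a = 'p], of j] j
        by (simp add: of_nat_binomial_eq_0_iff q_def del: One_nat_def)
      have "power_form q w = form q (\<lambda>i. if i = j then of_nat (q choose j) else 0)"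
        unfolding power_form_eq form_eq_iff by (auto simp: mom)
      also have "form q (\<lambda>i. if i = j then of_nat (q choose j) else 0) =
          const2 (of_nat (q choose j)) * varX ^ (q - j) * varY ^ j"
      proof -
        have "form q (\<lambda>i. if i = j then of_nat (q choose j) else 0) =
            (\<Sum>i\<le>q. if i = j then const2 (of_nat (q choose j)) * varX ^ (q - j) * varY ^ j else 0)"
          unfolding form_def by (intro sum.cong) auto
        thus ?thesis using j by simp
      qed
      finally have "const2 (c j / of_nat (q choose j)) * power_form q w =
          const2 (c j / of_nat (q choose j)) *
          (const2 (of_nat (q choose j)) * varX ^ (q - j) * varY ^ j)"
        by simp
      also have "const2 (c j / of_nat (q choose j)) *
          (const2 (of_nat (q choose j)) * varX ^ (q - j) * varY ^ j) =
          const2 (c j / of_nat (q choose j) * of_nat (q choose j)) * varX ^ (q - j) * varY ^ j"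
        by (simp only: const2.hom_mult mult.assoc)
      also have "\<dots> = const2 (c j) * varX ^ (q - j) * varY ^ j" using b by simp
      finally show ?thesis unfolding power_form_scale by metis
    qed
  qed
  then obtain w :: "nat \<Rightarrow> 'p mod_ring^2 \<Rightarrow> 'p mod_ring"
    where w: "\<And>j. j \<le> q \<Longrightarrow> const2 (c j) * varX ^ (q - j) * varY ^ j = power_form q (w j)"
    by metis
  have "form q c = (\<Sum>j\<le>q. power_form q (w j))"
    unfolding form_def by (intro sum.cong refl w) auto
  also have "\<dots> = power_form q (\<lambda>u. \<Sum>j\<le>q. w j u)"
    unfolding power_form_def hom_distribs sum_distrib_right by (rule sum.swap)
  finally show ?thesis unfolding q_def by blast
qed

text \<open>
  In degree \<open>2p - 1\<close> every monomial is divisible by exactly one of \<open>X\<^sup>p\<close> and \<open>Y\<^sup>p\<close>, and the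
  cofactors, of degree \<open>p - 1\<close>, are weighted sums of \<open>(p-1)\<close>-st powers.
\<close>
lemma binary_forms_eq_pair_forms:
  assumes p: "CARD('p::prime_card) > 2"
  shows "binary_forms (2 * CARD('p) - 1) = (pair_forms (CARD('p) - 1) :: 'p mod_ring poly poly set)"
proof -
  define q where "q = CARD('p) - 1"
  have deg: "2 * CARD('p) - 1 = q + CARD('p)" using p unfolding q_def by simp
  show ?thesis unfolding deg q_def[symmetric]
  proof
    show "binary_forms (q + CARD('p)) \<subseteq> (pair_forms q :: 'p mod_ring poly poly set)"
    proof
      fix F :: "'p mod_ring poly poly" assume "F \<in> binary_forms (q + CARD('p))"
      then obtain c where F: "F = form (q + CARD('p)) c" unfolding binary_forms_eq by blast
      have "F = varX ^ CARD('p) * form q c + varY ^ CARD('p) * form q (\<lambda>i. c (i + CARD('p)))"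
        unfolding F varX_power_mult_form varY_power_mult_form
        by (simp add: form_def flip: sum.distrib) (rule sum.cong, auto simp: q_def)
      thus "F \<in> pair_forms q"
        using power_form_surj[OF p, folded q_def] pair_form_in unfolding pair_form_def by metis
    qed
    show "(pair_forms q :: 'p mod_ring poly poly set) \<subseteq> binary_forms (q + CARD('p))"
    proof
      fix F :: "'p mod_ring poly poly" assume "F \<in> pair_forms q"
      then obtain v w where "F = pair_form q v w" by (elim pair_formsE)
      moreover have "form m c + form m d = form m (\<lambda>i. c i + d i)" for m and c d :: "nat \<Rightarrow> 'p mod_ring"
        by (simp add: form_def hom_distribs algebra_simps sum.distrib)
      ultimately show "F \<in> binary_forms (q + CARD('p))"
        unfolding binary_forms_eq pair_form_def power_form_eq varX_power_mult_form varY_power_mult_form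
        by simp
    qed
  qed
qed


section \<open>The map to the smallest exponent\<close>

text \<open>
  Replaces the exponent \<open>n\<close> by \<open>m\<close> while keeping a choice of weights. It is meaningful when weights
  that give zero for \<open>n\<close> give zero for \<open>m\<close>, since then the choice does not matter.
\<close>
definition transfer_pair_form ::
  "nat \<Rightarrow> nat \<Rightarrow> 'p::prime_card mod_ring poly poly \<Rightarrow> 'p mod_ring poly poly" where
  "transfer_pair_form n m F =
     (let (v, w) = (SOME (v, w). F = pair_form n v w) in pair_form m v w)"

lemma transfer_pair_form:
  fixes v w :: "'p::prime_card mod_ring^2 \<Rightarrow> 'p mod_ring"
  assumes ker: "\<And>v w :: 'p mod_ring^2 \<Rightarrow> 'p mod_ring. pair_form n v w = 0 \<Longrightarrow> pair_form m v w = 0"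
  shows "transfer_pair_form n m (pair_form n v w) = pair_form m v w"
proof -
  obtain v' w' where vw: "(SOME (v', w'). pair_form n v w = pair_form n v' w') = (v', w')"
    by fastforce
  have "pair_form n v w = pair_form n v' w'"
    using someI[of "\<lambda>(v', w'). pair_form n v w = pair_form n v' w'" "(v, w)"] vw by simp
  hence "pair_form n v w - pair_form n v' w' = 0" by simp
  hence "pair_form m v w - pair_form m v' w' = 0"
    unfolding pair_form_diff by (rule ker)
  thus ?thesis unfolding transfer_pair_form_def vw by simp
qed

lemma M_hom_transfer_pair_form:
  assumes ker: "\<And>v w :: 'p::prime_card mod_ring^2 \<Rightarrow> 'p mod_ring. pair_form n v w = 0 \<Longrightarrow> pair_form m v w = 0"
  shows "M_hom scale2 (pair_forms n :: 'p mod_ring poly poly set) mat_act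
    (pair_forms m) mat_act (transfer_pair_form n m)"
  unfolding M_hom_def
  by (auto elim!: pair_formsE simp: M_module_pair_forms transfer_pair_form[OF ker]
      pair_form_add pair_form_scale mat_act_pair_form)

lemma transfer_pair_form_image:
  assumes ker: "\<And>v w :: 'p::prime_card mod_ring^2 \<Rightarrow> 'p mod_ring. pair_form n v w = 0 \<Longrightarrow> pair_form m v w = 0"
  shows "transfer_pair_form n m ` pair_forms n = (pair_forms m :: 'p mod_ring poly poly set)"
  unfolding pair_forms_def by (force simp: image_iff transfer_pair_form[OF ker])

text \<open>
  Taking \<open>p\<close>-th powers identifies \<open>V\<^sub>1\<close> with the span of \<open>X\<^sup>p\<close> and \<open>Y\<^sup>p\<close>, and the twist is the
  character through which matrices act on \<open>\<Sum>\<^sub>u \<ell>\<^sub>u\<^sup>n\<close>.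
\<close>
lemma M_hom_kernel_embedding:
  assumes "n > 0"
  shows "M_hom scale2 (binary_forms 1 :: 'p::prime_card mod_ring poly poly set)
    (det_twist scale2 (CARD('p) - 1) mat_act) (pair_forms n) mat_act
    (\<lambda>F. power_form n (\<lambda>_. 1) * F ^ CARD('p))"
  unfolding M_hom_def
proof (intro conjI ballI allI)
  show "M_module scale2 (binary_forms 1 :: 'p mod_ring poly poly set)
      (det_twist scale2 (CARD('p) - 1) mat_act)"
    by (intro M_module_det_twist M_module_binary_forms_1)
next
  fix A :: "'p mod_ring^2^2" and F :: "'p mod_ring poly poly"
  show "power_form n (\<lambda>_. 1) * det_twist scale2 (CARD('p) - 1) mat_act A F ^ CARD('p) =
      mat_act A (power_form n (\<lambda>_. 1) * F ^ CARD('p))"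
    unfolding det_twist_def scale2_def mat_act.hom_mult mat_act.hom_power power_mult_distrib const2_power_card
      mat_act_power_form_one[OF assms]
    by (simp only: mult_ac)
next
  fix F :: "'p mod_ring poly poly" assume "F \<in> binary_forms 1"
  then obtain u where "F = linear_form u" unfolding binary_forms_1 by blast
  thus "power_form n (\<lambda>_. 1) * F ^ CARD('p) \<in> pair_forms n"
    by (simp only: power_form_mult_linear_form_power pair_form_in)
qed (auto simp: M_module_pair_forms poly2_add_power_card distrib_left scale2_def
      power_mult_distrib const2_power_card mult_ac)

text \<open>
  By independence over \<open>X\<^sup>p\<close> and \<open>Y\<^sup>p\<close>, at both exponents, the transfer from \<open>n\<close> to \<open>p - 1\<close> is well
  defined and its kernel is computed in each of the two components separately. There it is spanned
  by \<open>\<Theta> = \<Sum>\<^sub>u \<ell>\<^sub>u\<^sup>n\<close>, so the two cases are those of \<open>\<Theta> = 0\<close> and \<open>\<Theta> \<noteq> 0\<close>.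
\<close>
lemma pair_forms_extension:
  fixes n :: nat
  assumes n: "(CARD('p::prime_card) - 1) dvd n" "n > 0" and pn: "\<not> CARD('p) dvd n"
    and p: "CARD('p) > 2"
  shows "digit_sum CARD('p) n = CARD('p) - 1 \<Longrightarrow>
      M_isomorphic scale2 (pair_forms n :: 'p mod_ring poly poly set) mat_act
        (pair_forms (CARD('p) - 1)) mat_act"
    and "digit_sum CARD('p) n > CARD('p) - 1 \<Longrightarrow>
      M_short_exact scale2 (binary_forms 1 :: 'p mod_ring poly poly set)
        (det_twist scale2 (CARD('p) - 1) mat_act) (pair_forms n) mat_act
        (pair_forms (CARD('p) - 1)) mat_act"
proof -
  define q where "q = CARD('p) - 1"
  have q: "(CARD('p) - 1) dvd q" "q > 0" "\<not> CARD('p) dvd q"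
    using p by (auto simp: q_def dest: dvd_imp_le)
  define g :: "'p mod_ring poly poly \<Rightarrow> 'p mod_ring poly poly" where "g = transfer_pair_form n q"
  define \<Theta> :: "'p mod_ring poly poly" where "\<Theta> = power_form n (\<lambda>_. 1)"
  have ker: "pair_form q v w = 0" if "pair_form n v w = 0" for v w :: "'p mod_ring^2 \<Rightarrow> 'p mod_ring"
    using pair_form_eq_0[OF n pn p that] power_form_reduce[OF n p, folded q_def]
    unfolding pair_form_def by simp
  have hom: "M_hom scale2 (pair_forms n) mat_act (pair_forms q) mat_act g"
    unfolding g_def by (rule M_hom_transfer_pair_form[OF ker])
  have img: "g ` pair_forms n = pair_forms q"
    unfolding g_def by (rule transfer_pair_form_image[OF ker])
  have g: "g (pair_form n v w) = pair_form q v w" for v w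
    unfolding g_def by (rule transfer_pair_form[OF ker])
  have kernel: "\<exists>u. F = \<Theta> * linear_form u ^ CARD('p)" if F: "F \<in> pair_forms n" "g F = 0" for F
  proof -
    obtain v w where vw: "F = pair_form n v w" using F(1) by (elim pair_formsE)
    have 0: "power_form q v = 0" "power_form q w = 0"
      using pair_form_eq_0[OF q(1,2,3) p] F(2) unfolding vw g by blast+
    define u :: "'p mod_ring^2" where "u = (\<chi> i. if i = 1 then moment v q q else moment w q q)"
    have "F = \<Theta> * linear_form u ^ CARD('p)"
      unfolding vw pair_form_def linear_form_power_card \<Theta>_def
        power_form_of_kernel[OF n p 0(1)[unfolded q_def]] power_form_of_kernel[OF n p 0(2)[unfolded q_def]]
      by (simp add: u_def q_def algebra_simps)
    thus ?thesis by blast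
  qed
  have kernel': "\<Theta> * linear_form u ^ CARD('p) \<in> pair_forms n"
      "g (\<Theta> * linear_form u ^ CARD('p)) = 0" for u
  proof -
    note eq = power_form_mult_linear_form_power[of _ "\<lambda>_. 1" u]
    show "\<Theta> * linear_form u ^ CARD('p) \<in> pair_forms n" unfolding \<Theta>_def eq by simp
    have "digit_sum CARD('p) q = q"
      using digit_sum_add_mult[of "CARD('p)" q 0] p by (simp add: q_def)
    \<comment> \<open>at exponent \<open>p - 1\<close> itself the digit sum is minimal, so the analogue of \<open>\<Theta>\<close> vanishes\<close>
    hence "power_form q (\<lambda>_ :: 'p mod_ring^2. 1) = 0"
      using power_form_one_eq_0_iff[OF q(1,2)] by (simp add: q_def)
    thus "g (\<Theta> * linear_form u ^ CARD('p)) = 0"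
      unfolding \<Theta>_def eq g unfolding eq[symmetric] by simp
  qed
  {
    assume "digit_sum CARD('p) n = CARD('p) - 1"
    hence \<Theta>: "\<Theta> = 0" unfolding \<Theta>_def using power_form_one_eq_0_iff[OF n] by blast
    have "inj_on g (pair_forms n)"
    proof (rule inj_onI)
      fix F G assume *: "F \<in> pair_forms n" "G \<in> pair_forms n" "g F = g G"
      have "F - G \<in> pair_forms n" using * scale2.subspace_diff[OF subspace_pair_forms] by blast
      moreover have "g (F - G) + g G = g F"
        using hom * calculation unfolding M_hom_def by (metis diff_add_cancel)
      ultimately show "F = G" using kernel[of "F - G"] * \<Theta> by simp
    qed
    thus "M_isomorphic scale2 (pair_forms n :: 'p mod_ring poly poly set) mat_act
        (pair_forms (CARD('p) - 1)) mat_act"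
      using hom img unfolding M_isomorphic_def bij_betw_def q_def by blast
  }
  {
    assume "digit_sum CARD('p) n > CARD('p) - 1"
    hence \<Theta>: "\<Theta> \<noteq> 0" unfolding \<Theta>_def using power_form_one_eq_0_iff[OF n] by simp
    define f where "f F = \<Theta> * F ^ CARD('p)" for F
    have "M_hom scale2 (binary_forms 1) (det_twist scale2 (CARD('p) - 1) mat_act) (pair_forms n)
        mat_act f"
      unfolding f_def \<Theta>_def by (rule M_hom_kernel_embedding[OF n(2)])
    moreover have "inj_on f (binary_forms 1)"
    proof (rule inj_onI)
      fix F G assume "f F = f G"
      hence eq: "F ^ CARD('p) = G ^ CARD('p)" using \<Theta> by (simp add: f_def)
      have "((F - G) + G) ^ CARD('p) = (F - G) ^ CARD('p) + G ^ CARD('p)"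
        by (rule poly2_add_power_card)
      hence "(F - G) ^ CARD('p) = 0" using eq by simp
      thus "F = G" by simp
    qed
    moreover have "f ` binary_forms 1 = {F \<in> pair_forms n. g F = 0}"
    proof (intro equalityI subsetI)
      fix F assume "F \<in> {F \<in> pair_forms n. g F = 0}"
      then obtain u where "F = \<Theta> * linear_form u ^ CARD('p)" using kernel by blast
      thus "F \<in> f ` binary_forms 1" unfolding binary_forms_1 f_def by blast
    qed (use kernel' in \<open>auto simp only: binary_forms_1 f_def\<close>)
    ultimately show "M_short_exact scale2 (binary_forms 1 :: 'p mod_ring poly poly set)
        (det_twist scale2 (CARD('p) - 1) mat_act) (pair_forms n) mat_act
        (pair_forms (CARD('p) - 1)) mat_act"
      using hom img unfolding M_short_exact_def q_def by blast
  }
qed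

theorem theorem5p10:
  fixes p r :: nat
  assumes p_def: "p = CARD('p::prime_card)"
    and p_ge: "p \<ge> 3"
    and p_ndvd: "\<not> p dvd r"
    and r_gt: "2 * p < r"
    and r_cong: "[r = 1] (mod (p - 1))"
  shows
    "(digit_sum p (r - p) = p - 1 \<longrightarrow>
        M_isomorphic scale2
          (X_module (r - p) r :: 'p mod_ring poly poly set) mat_act
          (binary_forms (2 * p - 1)) mat_act) \<and>
     (digit_sum p (r - p) > p - 1 \<longrightarrow>
        M_short_exact scale2
          (binary_forms 1 :: 'p mod_ring poly poly set) (det_twist scale2 (p - 1) mat_act)
          (X_module (r - p) r) mat_act
          (binary_forms (2 * p - 1)) mat_act)"
proof -
  define n where "n = r - p"
  have r: "r = n + p" "n > 0" using r_gt unfolding n_def by auto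
  have "[n + p = 1] (mod (p - 1))" using r_cong unfolding r(1) .
  moreover have "n + p = n + 1 + (p - 1)" using p_ge by simp
  ultimately have "[n + 1 = 0 + 1] (mod (p - 1))" by (metis add_0 cong_def mod_add_self2)
  hence n: "(p - 1) dvd n" unfolding cong_add_rcancel_nat cong_0_iff .
  have pn: "\<not> p dvd n" using p_ndvd unfolding r(1) by simp
  have X: "X_module n r = (pair_forms n :: 'p mod_ring poly poly set)"
    unfolding r(1) p_def by (rule X_module_eq_pair_forms[OF r(2)])
  have p3: "CARD('p) > 2" using p_ge unfolding p_def by simp
  have V: "binary_forms (2 * p - 1) = (pair_forms (p - 1) :: 'p mod_ring poly poly set)"
    unfolding p_def by (rule binary_forms_eq_pair_forms[OF p3])
  note main = pair_forms_extension[OF n[unfolded p_def] r(2) pn[unfolded p_def] p3]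
  show ?thesis
    unfolding n_def[symmetric] X V unfolding p_def using main by blast
qed

end
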